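(* Let $A$ be an $n\times n$ nonsingular integer matrix having two or more (not necessarily distinct) eigenvalues outside the unit circle. Then the algebraic entropy of the (projective) monomial map from $\mathbb{CP}^n$ to itself associated with $A$ is strictly less than the topological entropy of that map.
   Context: Monomial maps. A nonsingular integer matrix $A=(a_{ij})_{i,j=1}^n$ determines the affine monomial map $(x_1,\dots,x_n)\mapsto(y_1,\dots,y_n)$, $y_i=\prod_j x_j^{a_{ij}}$, on a dense open subset of $\mathbb C^n$. The monomial map $f$ from $\mathbb{CP}^n$ to itself associated with $A$ is its projectivization, obtained from $(x_1:\dots:x_{n+1})\mapsto(y_1:\dots:y_n:1)$ with $y_i=\prod_j (x_j/x_{n+1})^{a_{ij}}$ by clearing denominators and removing common factors, so that it is written $(x_1:\dots:x_{n+1})\mapsto(p_1:\dots:p_{n+1})$ with $p_i$ monomials of the same degree with no joint common factor. It is undefined where all $p_i$ vanish. Algebraic entropy. The degree of a rational map from $\mathbb{CP}^n$ to itself is the common degree of its components when written as homogeneous polynomials of the same degree with no joint common factor. The algebraic entropy of $f$ is $\lim_{N\to\infty}\frac1N\log\deg(f^N)$, where $f^N$ is the $N$-fold composition, written with common factors removed (rational maps agreeing on a Zariski-dense set are identified). The limit exists. Topological entropy. Let $U\subseteq\mathbb{CP}^n$ be the set of points $x$ for which $f^N(x)$ (successive evaluation of $f$) is defined for all $N\ge1$. It is dense and open, $f(U)\subseteq U$, and $f|_U$ is continuous. Put on $\mathbb{CP}^n$ the metric $d$ in which the distance between two points is the angle $\theta\in[0,\pi/2]$ between the corresponding complex lines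 in $\mathbb C^{n+1}$. The topological entropy of $f$ is the Bowen–Dinaburg entropy of $f|_U$ with respect to $d$: if $s(N,\varepsilon)$ is the maximal cardinality of a set $E\subseteq U$ such that any two distinct $x,y\in E$ satisfy $\max_{0\le k<N}d(f^k(x),f^k(y))>\varepsilon$, the entropy is $\lim_{\varepsilon\to0}\limsup_{N\to\infty}\frac1N\log s(N,\varepsilon)$. *)

theory Defs
  imports "HOL-Analysis.Analysis" "HOL-Library.Poly_Mapping" "HOL-Computational_Algebra.Polynomial"
begin

definition charpoly :: "int ^ 'n ^ 'n \<Rightarrow> complex poly" where
  "charpoly A = det (mat [:0, 1:] - map_matrix (\<lambda>a. [:of_int a:]) A)"

text \<open>Counted with algebraic multiplicity.\<close>
definition eigenvalues :: "int ^ 'n ^ 'n \<Rightarrow> complex multiset" where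
  "eigenvalues A = proots (charpoly A)"

definition proj_rel :: "complex ^ 'm \<Rightarrow> complex ^ 'm \<Rightarrow> bool" where
  "proj_rel x y \<longleftrightarrow> x \<noteq> 0 \<and> y \<noteq> 0 \<and> (\<exists>c. y = c *s x)"

lemma part_equivp_proj_rel: "part_equivp (proj_rel :: complex ^ 'm \<Rightarrow> complex ^ 'm \<Rightarrow> bool)"
proof (rule part_equivpI)
  have "proj_rel (axis undefined 1) (axis undefined 1 :: complex ^ 'm)"
    unfolding proj_rel_def by (auto intro: exI[of _ 1] simp: vec_eq_iff axis_def)
  then show "\<exists>x. proj_rel x (x :: complex ^ 'm)" by blast
  show "symp (proj_rel :: complex ^ 'm \<Rightarrow> _)"
  proof (rule sympI)
    fix x y :: "complex ^ 'm"
    assume xy: "proj_rel x y"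
    then obtain c where c: "y = c *s x" by (auto simp: proj_rel_def)
    with xy have "c \<noteq> 0" by (auto simp: proj_rel_def)
    then have "x = inverse c *s y" by (simp add: c vec_eq_iff)
    with xy show "proj_rel y x" by (auto simp: proj_rel_def)
  qed
  show "transp (proj_rel :: complex ^ 'm \<Rightarrow> _)"
    unfolding transp_def proj_rel_def by (metis vector_smult_assoc)
qed

text \<open>If the index type has $n+1$ elements, this is $\mathbb{CP}^n$.\<close>
quotient_type 'm cproj = "complex ^ 'm" / partial: proj_rel
  by (rule part_equivp_proj_rel)

definition hermitian_inner :: "complex ^ 'm \<Rightarrow> complex ^ 'm \<Rightarrow> complex" where
  "hermitian_inner x y = (\<Sum>i\<in>UNIV. x $ i * cnj (y $ i))"

lemma norm_smult_complex: "norm (c *s x) = norm c * norm (x :: complex ^ 'm)"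
  by (simp add: norm_vec_def norm_mult L2_set_right_distrib)

text \<open>The angle in $[0,\pi/2]$ between two complex lines.\<close>
lift_definition cproj_dist :: "('m :: finite) cproj \<Rightarrow> 'm cproj \<Rightarrow> real" is
  "\<lambda>x y. arccos (norm (hermitian_inner x y) / (norm x * norm y))"
proof -
  fix x x' y y' :: "complex ^ 'm"
  assume "proj_rel x x'" "proj_rel y y'"
  then obtain c e where ce: "x' = c *s x" "y' = e *s y" "c \<noteq> 0" "e \<noteq> 0"
    by (auto simp: proj_rel_def)
  have "hermitian_inner x' y' = c * cnj e * hermitian_inner x y"
    by (simp add: hermitian_inner_def ce sum_distrib_left mult_ac)
  with ce show "arccos (norm (hermitian_inner x y) / (norm x * norm y)) =
      arccos (norm (hermitian_inner x' y') / (norm x' * norm y'))"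
    by (simp add: norm_smult_complex norm_mult)
qed

text \<open>Polynomials are finitely supported functions from monomials (exponent vectors)
  to coefficients; their ring structure is the library's convolution product.\<close>
type_synonym 'm cpoly = "('m \<Rightarrow>\<^sub>0 nat) \<Rightarrow>\<^sub>0 complex"

definition pvar :: "'m \<Rightarrow> 'm cpoly" where
  "pvar j = Poly_Mapping.single (Poly_Mapping.single j 1) 1"

definition peval :: "('m :: finite) cpoly \<Rightarrow> complex ^ 'm \<Rightarrow> complex" where
  "peval p x = (\<Sum>m\<in>Poly_Mapping.keys p.
     Poly_Mapping.lookup p m * (\<Prod>j\<in>UNIV. x $ j ^ Poly_Mapping.lookup m j))"

definition homogeneous :: "nat \<Rightarrow> ('m :: finite) cpoly \<Rightarrow> bool" where
  "homogeneous d p \<longleftrightarrow>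
     (\<forall>m\<in>Poly_Mapping.keys p. (\<Sum>j\<in>UNIV. Poly_Mapping.lookup m j) = d)"

definition no_common_factor :: "('m \<Rightarrow> 'm cpoly) \<Rightarrow> bool" where
  "no_common_factor P \<longleftrightarrow> (\<forall>h. (\<forall>i. h dvd P i) \<longrightarrow> h dvd 1)"

text \<open>The partial map $x \mapsto (P_1(x) : \dots : P_{n+1}(x))$, undefined where all
  components vanish. It does not depend on the chosen representative
  if the components are homogeneous of the same degree.\<close>
definition poly_map :: "(('m :: finite) \<Rightarrow> 'm cpoly) \<Rightarrow> 'm cproj \<rightharpoonup> 'm cproj" where
  "poly_map P \<xi> = (let y = (\<chi> i. peval (P i) (rep_cproj \<xi>)) in
     if y = 0 then None else Some (abs_cproj y))"

text \<open>Every proper Zariski-closed set lies in the zero set of one nonzero homogeneous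
  polynomial, so it suffices to test against these.\<close>
definition zariski_dense :: "('m :: finite) cproj set \<Rightarrow> bool" where
  "zariski_dense S \<longleftrightarrow>
     (\<forall>d h. homogeneous d h \<and> (\<forall>\<xi>\<in>S. peval h (rep_cproj \<xi>) = 0) \<longrightarrow> h = 0)"

definition reduced_form :: "('m :: finite cproj \<rightharpoonup> 'm cproj) \<Rightarrow> nat \<Rightarrow> ('m \<Rightarrow> 'm cpoly) \<Rightarrow> bool" where
  "reduced_form g d P \<longleftrightarrow> (\<forall>i. homogeneous d (P i)) \<and> no_common_factor P \<and>
     zariski_dense {\<xi> \<in> dom g. g \<xi> = poly_map P \<xi>}"

text \<open>Meaningful for rational maps, that is, partial maps given by
  homogeneous polynomials on a nonempty Zariski-open set.\<close>
definition map_degree :: "('m :: finite cproj \<rightharpoonup> 'm cproj) \<Rightarrow> nat" where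
  "map_degree g = (THE d. \<exists>P. reduced_form g d P)"

text \<open>Successive evaluation: defined at $x$ only if all intermediate values are.\<close>
primrec map_iter :: "('a \<rightharpoonup> 'a) \<Rightarrow> nat \<Rightarrow> ('a \<rightharpoonup> 'a)" where
  "map_iter f 0 = Some"
| "map_iter f (Suc N) = f \<circ>\<^sub>m map_iter f N"

definition algebraic_entropy :: "('m :: finite cproj \<rightharpoonup> 'm cproj) \<Rightarrow> real" where
  "algebraic_entropy f = lim (\<lambda>N. ln (real (map_degree (map_iter f N))) / real N)"

definition bowen_separated ::
  "('a \<Rightarrow> 'a \<Rightarrow> real) \<Rightarrow> ('a \<Rightarrow> 'a) \<Rightarrow> nat \<Rightarrow> real \<Rightarrow> 'a set \<Rightarrow> bool" where
  "bowen_separated d T N \<epsilon> E \<longleftrightarrow>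
     (\<forall>x\<in>E. \<forall>y\<in>E. x \<noteq> y \<longrightarrow> Max ((\<lambda>k. d ((T ^^ k) x) ((T ^^ k) y)) ` {..<N}) > \<epsilon>)"

text \<open>The supremum is taken over finite sets and is infinite if these are
  arbitrarily large.\<close>
definition max_separated ::
  "'a set \<Rightarrow> ('a \<Rightarrow> 'a \<Rightarrow> real) \<Rightarrow> ('a \<Rightarrow> 'a) \<Rightarrow> nat \<Rightarrow> real \<Rightarrow> enat" where
  "max_separated U d T N \<epsilon> =
     Sup {enat (card E) | E. E \<subseteq> U \<and> finite E \<and> bowen_separated d T N \<epsilon> E}"

definition ln_enat :: "enat \<Rightarrow> ereal" where
  "ln_enat s = (case s of enat k \<Rightarrow> ereal (ln (real k)) | \<infinity> \<Rightarrow> \<infinity>)"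

definition bowen_dinaburg_entropy ::
  "'a set \<Rightarrow> ('a \<Rightarrow> 'a \<Rightarrow> real) \<Rightarrow> ('a \<Rightarrow> 'a) \<Rightarrow> ereal" where
  "bowen_dinaburg_entropy U d T =
     Lim (at_right 0) (\<lambda>\<epsilon>. limsup (\<lambda>N. ln_enat (max_separated U d T N \<epsilon>) / ereal (real N)))"

definition forever_defined :: "('a \<rightharpoonup> 'a) \<Rightarrow> 'a set" where
  "forever_defined f = {x. \<forall>N\<ge>1. x \<in> dom (map_iter f N)}"

definition topological_entropy :: "('m :: finite cproj \<rightharpoonup> 'm cproj) \<Rightarrow> ereal" where
  "topological_entropy f = bowen_dinaburg_entropy (forever_defined f) cproj_dist (the \<circ> f)"

text \<open>The exponent of the homogeneous coordinate $x_j$ in the $i$-th coordinate of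
  $(y_1 : \dots : y_n : 1)$, $y_i = \prod_j (x_j / x_{n+1})^{a_{ij}}$. The index \<open>None\<close>
  plays the role of $n+1$.\<close>
fun laurent_exponent :: "int ^ 'n ^ 'n \<Rightarrow> 'n option \<Rightarrow> 'n option \<Rightarrow> int" where
  "laurent_exponent A (Some i) (Some j) = A $ i $ j"
| "laurent_exponent A (Some i) None = - (\<Sum>j\<in>UNIV. A $ i $ j)"
| "laurent_exponent A None j = 0"

text \<open>Subtracting the least exponent of each variable both clears denominators and
  removes all common factors.\<close>
definition monomial_exponent :: "int ^ 'n ^ 'n \<Rightarrow> 'n option \<Rightarrow> 'n option \<Rightarrow> nat" where
  "monomial_exponent A i j =
     nat (laurent_exponent A i j - Min (range (\<lambda>k. laurent_exponent A k j)))"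

definition monomial_component :: "int ^ 'n ^ 'n \<Rightarrow> 'n option \<Rightarrow> 'n option cpoly" where
  "monomial_component A i = (\<Prod>j\<in>UNIV. pvar j ^ monomial_exponent A i j)"

definition monomial_map :: "int ^ 'n ^ 'n \<Rightarrow> 'n option cproj \<rightharpoonup> 'n option cproj" where
  "monomial_map A = poly_map (monomial_component A)"

end

theory Submission
  imports Defs "HOL-Computational_Algebra.Fundamental_Theorem_Algebra" "HOL-Real_Asymp.Real_Asymp"
begin

text \<open>Let \<open>\<alpha>\<close> be an eigenvalue of \<open>A\<close> of largest modulus and \<open>\<mu>\<close> a second eigenvalue outside the unit circle. The
algebraic entropy equals \<open>ln |\<alpha>|\<close>, and the topological entropy is at least \<open>ln |\<alpha>| + ln |\<mu>|\<close>, because the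
degree of an iterate sees only the fastest expanding direction, whereas orbits also separate in the
second one.

Algebraic side. On the torus of points without zero coordinates the map is given by Laurent
monomials, and composition multiplies the exponent matrices (\<open>laurent_map_compose\<close>). The torus is open and
Zariski dense, so every reduced form of the \<open>N\<close>-th iterate is proportional to the one read off from
\<open>A\<^sup>N\<close>; as both lack a common factor, their degrees agree (\<open>monomials_proportional_degree\<close>,
\<open>map_degree_eq\<close>). This degree is comparable to the largest entry of \<open>A\<^sup>N\<close>. An eigenvector for
\<open>\<alpha>\<close> bounds the entries of \<open>A\<^sup>N\<close> from below by a multiple of \<open>|\<alpha>|\<^sup>N\<close>, and they are at most
\<open>C r\<^sup>N\<close> for every \<open>r > |\<alpha>|\<close> (\<open>matrix_orbit_growth\<close>). Hence the limit exists and is \<open>ln |\<alpha>|\<close>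
(\<open>algebraic_entropy_eq\<close>).

Topological side. Points all of whose coordinates have modulus one form an invariant compact torus,
and in the angles of the coordinates the map is the linear map \<open>A\<close> modulo integers. There are
independent linear functionals \<open>x\<close>, \<open>y\<close> that \<open>A\<close> maps to \<open>\<alpha> x\<close> and \<open>\<mu> y + c x\<close>
(\<open>triangular_pair\<close>). If two nearby angle vectors stay close for \<open>M\<close> steps, then their difference has
\<open>x\<close>-value of size at most \<open>|\<alpha>|\<^sup>-\<^sup>M\<close> and \<open>y\<close>-value of size at most \<open>M |\<mu>|\<^sup>-\<^sup>M\<close>, up to constants
(\<open>backward_decay\<close>). A small planar grid whose two spacings exceed these bounds is therefore
separated, and it contains about \<open>(|\<alpha>| |\<mu>|)\<^sup>M / M\<close> points (\<open>separated_family\<close>). No invariant measure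
or volume is involved, only the counting of grid points. The choice of two real directions works
uniformly: it covers real and complex eigenvalues as well as a Jordan block with \<open>\<alpha> = \<mu>\<close>.\<close>

section \<open>Eigenvectors\<close>

lemma poly_det: "poly (det M) z = det (\<chi> i j. poly (M $ i $ j) z)"
  for M :: "complex poly ^ 'n ^ 'n"
  by (simp add: det_def poly_sum poly_prod)

text \<open>The transpose appears because linear functionals that \<open>A\<close> scales, that is, left eigenvectors, are
needed below.\<close>
lemma charpoly_eval:
  fixes A :: "int ^ 'n ^ 'n"
  shows "poly (charpoly A) z = det (mat z - transpose (map_matrix of_int A))"
proof -
  have "poly (charpoly A) z = det (mat z - map_matrix of_int A :: complex ^ 'n ^ 'n)"
    unfolding charpoly_def poly_det
    by (rule arg_cong[where f = det]) (simp add: vec_eq_iff mat_def map_matrix_def)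
  also have "\<dots> = det (transpose (mat z - map_matrix of_int A :: complex ^ 'n ^ 'n))"
    by simp
  also have "transpose (mat z - map_matrix of_int A :: complex ^ 'n ^ 'n)
      = mat z - transpose (map_matrix of_int A)"
    by (auto simp: vec_eq_iff transpose_def mat_def)
  finally show ?thesis .
qed

lemma singular_iff_kernel:
  fixes M :: "'a::field ^ 'n ^ 'n"
  shows "det M = 0 \<longleftrightarrow> (\<exists>x. x \<noteq> 0 \<and> M *v x = 0)"
  using invertible_det_nz[of M] matrix_left_invertible_ker[of M] invertible_left_inverse[of M] by blast

lemma mat_vector_mul [simp]: "mat z *v x = z *s x" for x :: "complex ^ 'n"
  by (simp add: vec_eq_iff matrix_vector_mult_def mat_def if_distrib if_distribR cong: if_cong)

text \<open>Two roots of the characteristic polynomial, counted with multiplicity, give a two-dimensional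
invariant space on which \<open>B\<close> is triangular. Take an eigenvector \<open>x\<close> for \<open>\<alpha>\<close> with \<open>x $ k \<noteq> 0\<close>. By Cramer's
rule, replacing column \<open>k\<close> of \<open>z - B\<close> by \<open>(z - B) x = (z - \<alpha>) x\<close> multiplies the determinant by \<open>x $ k\<close>.
So the linear factor \<open>z - \<alpha>\<close> splits off, and the cofactor is the determinant of \<open>z - B\<close> with column
\<open>k\<close> replaced by \<open>x\<close>. That matrix is singular at the second root \<open>\<mu>\<close>, and a vector in its kernel
yields \<open>y\<close>.\<close>
lemma triangular_pair:
  fixes B :: "complex ^ 'n ^ 'n"
  assumes p: "\<And>z. poly p z = det (mat z - B)" and nz: "p \<noteq> 0"
    and roots: "{#\<alpha>, \<mu>#} \<subseteq># proots p"
  obtains x y c where "B *v x = \<alpha> *s x" "B *v y = \<mu> *s y + c *s x"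
    "\<And>a b. a *s x + b *s y = 0 \<Longrightarrow> a = 0 \<and> b = 0"
proof -
  have "\<alpha> \<in># proots p" using mset_subset_eqD[OF roots] by simp
  then have "det (mat \<alpha> - B) = 0" using nz p by simp
  then obtain x where x: "x \<noteq> 0" "(mat \<alpha> - B) *v x = 0"
    by (auto simp: singular_iff_kernel)
  have Bx: "B *v x = \<alpha> *s x" using x(2) by (simp add: matrix_vector_mult_diff_rdistrib)
  obtain k where k: "x $ k \<noteq> 0" using x(1) by (auto simp: vec_eq_iff)
  define C where "C z = (\<chi> i j. if j = k then x $ i else (mat z - B) $ i $ j)" for z
  define q where "q = det (\<chi> i j. if j = k then [:x $ i:]
      else (mat [:0, 1:] :: complex poly ^ 'n ^ 'n) $ i $ j - [:B $ i $ j:])"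
  have q: "poly q z = det (C z)" for z
    unfolding q_def poly_det C_def by (rule arg_cong[where f = det]) (simp add: vec_eq_iff mat_def)
  have eval: "x $ k * poly p z = (z - \<alpha>) * poly q z" for z
  proof -
    have col: "C z *v axis k (z - \<alpha>) = (z - \<alpha>) *s x"
      by (simp add: vec_eq_iff matrix_vector_mult_def axis_def C_def if_distrib algebra_simps cong: if_cong)
    have "(mat z - B) *v x = (z - \<alpha>) *s x"
      by (simp add: matrix_vector_mult_diff_rdistrib Bx vector_sub_rdistrib)
    then have "x $ k * det (mat z - B)
        = det (\<chi> i j. if j = k then ((z - \<alpha>) *s x) $ i else (mat z - B) $ i $ j)"
      using cramer_lemma[of k "mat z - B" x] by (simp only:)
    also have "\<dots> = det (\<chi> i j. if j = k then (C z *v axis k (z - \<alpha>)) $ i else C z $ i $ j)"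
      unfolding col by (rule arg_cong[where f = det]) (simp add: vec_eq_iff C_def)
    also have "\<dots> = (z - \<alpha>) * det (C z)"
      unfolding cramer_lemma by (simp add: axis_def)
    finally show ?thesis by (simp add: p q)
  qed
  have eq: "smult (x $ k) p = [:- \<alpha>, 1:] * q"
    by (rule poly_ext) (simp add: eval algebra_simps)
  have qnz: "q \<noteq> 0" using eq nz k by auto
  have "proots p = add_mset \<alpha> (proots q)"
    using arg_cong[OF eq, of proots] k qnz by (subst (asm) proots_mult) auto
  then have "\<mu> \<in># proots q" using roots by simp
  then have "det (C \<mu>) = 0" using qnz q by simp
  then obtain u where u: "u \<noteq> 0" "C \<mu> *v u = 0" by (auto simp: singular_iff_kernel)
  \<comment> \<open>The entry \<open>u $ k\<close> is the coefficient of the column \<open>x\<close>; what remains of \<open>u\<close> is \<open>y\<close>, and \<open>y $ k = 0 \<noteq> x $ k\<close> makes the pair independent.\<close>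
  define y where "y = (\<chi> i. if i = k then 0 else u $ i)"
  have sum: "C \<mu> *v u = u $ k *s x + (mat \<mu> - B) *v y"
    by (simp add: vec_eq_iff matrix_vector_mult_def C_def y_def sum.remove[of UNIV k] mult.commute)
  have By: "B *v y = \<mu> *s y + u $ k *s x"
    using u(2) unfolding sum by (simp add: matrix_vector_mult_diff_rdistrib algebra_simps)
  have ynz: "y \<noteq> 0"
  proof
    assume y0: "y = 0"
    then have "u $ k *s x = 0" using By by simp
    then have "u $ k = 0" using x(1) by (auto simp: vec_eq_iff)
    with y0 have "u = 0" by (auto simp: vec_eq_iff y_def split: if_splits)
    with u(1) show False ..
  qed
  have "a = 0 \<and> b = 0" if "a *s x + b *s y = 0" for a b
  proof -
    have "a * x $ k = 0" using arg_cong[OF that, of "\<lambda>v. v $ k"] by (simp add: y_def)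
    with k have "a = 0" by simp
    with that ynz show ?thesis by (auto simp: vec_eq_iff)
  qed
  with Bx By show thesis by (rule that)
qed

section \<open>Growth of the orbits of a complex matrix\<close>

text \<open>This is \<open>p(B) v\<close>. Iterates of the map \<open>v \<mapsto> B v\<close> stand for the powers of \<open>B\<close>, since \<open>(^)\<close> on this
type is componentwise.\<close>
definition poly_action :: "complex ^ 'n ^ 'n \<Rightarrow> complex poly \<Rightarrow> complex ^ 'n \<Rightarrow> complex ^ 'n" where
  "poly_action B p v = (\<Sum>i\<le>degree p. coeff p i *s ((*v) B ^^ i) v)"

lemma poly_action_bound:
  "degree p \<le> n \<Longrightarrow> poly_action B p v = (\<Sum>i\<le>n. coeff p i *s ((*v) B ^^ i) v)"
  unfolding poly_action_def by (rule sum.mono_neutral_left) (auto simp: coeff_eq_0)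

lemma funpow_mult_add: "((*v) B ^^ i) (v + w) = ((*v) B ^^ i) v + ((*v) B ^^ i) w"
  for B :: "complex ^ 'n ^ 'n"
  by (induction i) (simp_all add: matrix_vector_right_distrib)

lemma funpow_mult_scale: "((*v) B ^^ i) (c *s v) = c *s ((*v) B ^^ i) v"
  for B :: "complex ^ 'n ^ 'n"
  by (induction i) (simp_all add: vector_scalar_commute)

lemma poly_action_linear_factor:
  "poly_action B ([:- \<mu>, 1:] * q) v = poly_action B q (B *v v - \<mu> *s v)"
proof -
  define n where "n = degree q"
  have 1: "poly_action B ([:- \<mu>, 1:] * q) v
     = (\<Sum>i\<le>Suc n. coeff ([:- \<mu>, 1:] * q) i *s ((*v) B ^^ i) v)"
    by (rule poly_action_bound) (use degree_mult_le[of "[:- \<mu>, 1:]" q] in \<open>simp add: n_def\<close>)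
  have c: "[:- \<mu>, 1:] * q = pCons 0 q - smult \<mu> q" by simp
  have 2: "(\<Sum>i\<le>Suc n. coeff (pCons 0 q) i *s ((*v) B ^^ i) v)
      = (\<Sum>i\<le>n. coeff q i *s ((*v) B ^^ i) (B *v v))"
    by (subst sum.atMost_Suc_shift) (simp add: funpow_swap1)
  have 3: "(\<Sum>i\<le>Suc n. coeff (smult \<mu> q) i *s ((*v) B ^^ i) v)
      = (\<Sum>i\<le>n. coeff q i *s ((*v) B ^^ i) (\<mu> *s v))"
    by (simp add: n_def coeff_eq_0 funpow_mult_scale vector_smult_assoc mult.commute)
  have 4: "((*v) B ^^ i) (B *v v - \<mu> *s v) = ((*v) B ^^ i) (B *v v) - ((*v) B ^^ i) (\<mu> *s v)" for i
    using funpow_mult_add[where v = "B *v v - \<mu> *s v" and w = "\<mu> *s v" and i = i and B = B]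
    by (simp add: algebra_simps)
  have "poly_action B ([:- \<mu>, 1:] * q) v =
      (\<Sum>i\<le>Suc n. coeff (pCons 0 q) i *s ((*v) B ^^ i) v)
      - (\<Sum>i\<le>Suc n. coeff (smult \<mu> q) i *s ((*v) B ^^ i) v)"
    by (simp only: 1[unfolded c] c coeff_diff vector_sub_rdistrib sum_subtractf)
  also have "\<dots> = (\<Sum>i\<le>n. coeff q i *s ((*v) B ^^ i) (B *v v - \<mu> *s v))"
    unfolding 2 3 4 by (simp only: vector_ssub_ldistrib sum_subtractf)
  finally show ?thesis by (simp add: poly_action_def n_def)
qed

text \<open>More orbit points than the real dimension of the space are linearly dependent or not distinct.\<close>
lemma annihilating_poly:
  fixes B :: "complex ^ 'n ^ 'n"
  obtains p where "p \<noteq> 0" "poly_action B p v = 0"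
proof -
  let ?b = "\<lambda>i. ((*v) B ^^ i) v"
  define m where "m = DIM(complex ^ 'n)"
  show thesis
  proof (cases "inj_on ?b {..m}")
    case True
    then have "dependent (?b ` {..m})"
      by (intro dependent_biggerset) (simp add: card_image m_def)
    then obtain u where u: "(\<Sum>w\<in>?b ` {..m}. u w *\<^sub>R w) = 0" "\<exists>w\<in>?b ` {..m}. u w \<noteq> 0"
      by (subst (asm) dependent_finite) auto
    define p where "p = (\<Sum>i\<le>m. monom (complex_of_real (u (?b i))) i)"
    have cf: "coeff p i = (if i \<le> m then of_real (u (?b i)) else 0)" for i
      by (auto simp: p_def coeff_sum if_distrib cong: if_cong)
    have "degree p \<le> m" by (rule degree_le) (simp add: cf)
    then have "poly_action B p v = (\<Sum>i\<le>m. u (?b i) *\<^sub>R ?b i)"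
      by (simp add: poly_action_bound cf vec_eq_iff scaleR_conv_of_real[where 'a = complex])
    also have "\<dots> = 0" using u(1) by (simp add: sum.reindex[OF True])
    finally have "poly_action B p v = 0" .
    moreover obtain i where "i \<le> m" "u (?b i) \<noteq> 0" using u(2) by auto
    then have "coeff p i \<noteq> 0" by (simp add: cf)
    then have "p \<noteq> 0" by auto
    ultimately show thesis using that by blast
  next
    case False
    then obtain i j where ij: "i \<noteq> j" "?b i = ?b j" by (auto simp: inj_on_def)
    define p where "p = monom (1::complex) i - monom 1 j"
    have "degree p \<le> max i j" unfolding p_def by (rule degree_diff_le_max[THEN order_trans]) (simp add: degree_monom_eq)
    moreover have "coeff (monom (1::complex) a) l *s ?b l = (if l = a then ?b a else 0)" for a l
      by (cases "l = a") simp_all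
    ultimately have "poly_action B p v = ?b i - ?b j"
      by (simp add: poly_action_bound p_def vector_sub_rdistrib sum_subtractf del: coeff_monom)
    moreover have "p \<noteq> 0" using ij(1) by (metis coeff_monom eq_iff_diff_eq_0 p_def zero_neq_one)
    ultimately show thesis using that ij(2) by simp
  qed
qed

text \<open>Solving the recursion expresses \<open>a N\<close> by powers of \<open>\<mu>\<close> and by the forcing term; since \<open>|\<mu>| < r\<close>, the
geometric series that arises converges relative to \<open>r\<^sup>N\<close>. The constant \<open>D\<close> is chosen such that the
induction step closes exactly.\<close>
lemma geometric_bound_of_recursion:
  fixes a :: "nat \<Rightarrow> complex ^ 'n"
  assumes r: "0 < r" "norm \<mu> < r" and C: "\<And>N. norm (a (Suc N) - \<mu> *s a N) \<le> C * r ^ N"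
  shows "\<exists>D. \<forall>N. norm (a N) \<le> D * r ^ N"
proof -
  define D where "D = max (norm (a 0)) (C / (r - norm \<mu>))"
  have D: "C \<le> D * (r - norm \<mu>)" using r by (simp add: D_def pos_divide_le_eq[symmetric])
  have "norm (a N) \<le> D * r ^ N" for N
  proof (induction N)
    case 0 show ?case by (simp add: D_def)
  next
    case (Suc N)
    have "norm (a (Suc N)) \<le> norm (a (Suc N) - \<mu> *s a N) + norm (\<mu> *s a N)"
      by (metis diff_add_cancel norm_triangle_ineq)
    also have "\<dots> \<le> C * r ^ N + norm \<mu> * (D * r ^ N)"
      using C[of N] Suc by (intro add_mono) (simp_all add: norm_smult_complex mult_left_mono)
    also have "\<dots> \<le> (D * (r - norm \<mu>)) * r ^ N + norm \<mu> * (D * r ^ N)"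
      using D r by (simp add: mult_right_mono)
    also have "\<dots> = D * r ^ Suc N" by (simp add: algebra_simps)
    finally show ?case .
  qed
  then show ?thesis by blast
qed

text \<open>The upper half of the spectral radius formula, along one orbit. Induction on the degree of a
polynomial \<open>p\<close> with \<open>p(B) v = 0\<close>: splitting off a root \<open>\<mu>\<close> leaves a polynomial of smaller degree that
annihilates \<open>w = B v - \<mu> v\<close>. A root of modulus below \<open>r\<close> costs a constant, by the recursion lemma. Any
other root is not an eigenvalue, so \<open>v\<close> is recovered from \<open>w\<close> by an invertible matrix that commutes
with \<open>B\<close>.\<close>
lemma matrix_orbit_growth:
  fixes B :: "complex ^ 'n ^ 'n"
  assumes r: "0 < r" and spec: "\<And>z. r \<le> norm z \<Longrightarrow> det (mat z - B) \<noteq> 0"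
  shows "\<exists>C. \<forall>N. norm (((*v) B ^^ N) v) \<le> C * r ^ N"
proof -
  have main: "p \<noteq> 0 \<Longrightarrow> degree p = d \<Longrightarrow> poly_action B p v = 0 \<Longrightarrow>
      \<exists>C. \<forall>N. norm (((*v) B ^^ N) v) \<le> C * r ^ N" for p d v
  proof (induction d arbitrary: p v)
    case 0
    then have "coeff p 0 \<noteq> 0" by (metis leading_coeff_0_iff)
    with 0 have "v = 0" by (simp add: poly_action_def vec_eq_iff)
    then have "((*v) B ^^ N) v = 0" for N by (induction N) auto
    then show ?case by (auto intro: exI[of _ 0])
  next
    case (Suc d)
    then have "\<not> constant (poly p)" by (simp add: constant_degree)
    then obtain \<mu> where "poly p \<mu> = 0" using fundamental_theorem_of_algebra by blast
    then obtain q where q: "p = [:- \<mu>, 1:] * q" by (auto simp: poly_eq_0_iff_dvd)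
    have "q \<noteq> 0" using q Suc.prems by auto
    then have "degree q = d" 
      using Suc.prems(2) degree_mult_eq[of "[:- \<mu>, 1:]" q] unfolding q by simp
    moreover define w where "w = B *v v - \<mu> *s v"
    moreover have "poly_action B q w = 0" using Suc.prems q poly_action_linear_factor w_def by metis
    ultimately obtain C where C: "\<And>N. norm (((*v) B ^^ N) w) \<le> C * r ^ N"
      using Suc.IH[OF \<open>q \<noteq> 0\<close>] by blast
    have orb: "((*v) B ^^ N) w = ((*v) B ^^ Suc N) v - \<mu> *s ((*v) B ^^ N) v" for N
    proof -
      have "((*v) B ^^ N) (w + \<mu> *s v) = ((*v) B ^^ N) w + \<mu> *s ((*v) B ^^ N) v"
        by (simp add: funpow_mult_add funpow_mult_scale)
      moreover have "((*v) B ^^ N) (w + \<mu> *s v) = ((*v) B ^^ Suc N) v"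
        by (simp add: w_def funpow_swap1)
      ultimately show ?thesis by (simp add: algebra_simps)
    qed
    show ?case
    proof (cases "norm \<mu> < r")
      case True
      show ?thesis by (rule geometric_bound_of_recursion[OF r True C[unfolded orb]])
    next
      case False
      then have "invertible (mat \<mu> - B)" using spec[of \<mu>] by (simp add: invertible_det_nz)
      then obtain E where E: "E ** (mat \<mu> - B) = mat 1" by (auto simp: invertible_def)
      have rep: "((*v) B ^^ N) v = - (E *v ((*v) B ^^ N) w)" for N
      proof -
        have "(mat \<mu> - B) *v ((*v) B ^^ N) v = - (((*v) B ^^ N) w)"
          unfolding orb by (simp add: matrix_vector_mult_diff_rdistrib)
        then have "E *v ((mat \<mu> - B) *v ((*v) B ^^ N) v) = - (E *v ((*v) B ^^ N) w)"
          by (simp only: diff_0[symmetric] matrix_vector_mult_diff_distrib matrix_vector_mult_0_right)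
        then show ?thesis by (simp add: matrix_vector_mul_assoc E)
      qed
      obtain K where K0: "0 < K" and K: "\<And>x. norm (E *v x) \<le> norm x * K"
        using bounded_linear.pos_bounded[OF matrix_vector_mul_bounded_linear[of E]] by blast
      have "norm (((*v) B ^^ N) v) \<le> (C * K) * r ^ N" for N
      proof -
        have "norm (((*v) B ^^ N) v) \<le> norm (((*v) B ^^ N) w) * K"
          by (simp only: rep norm_minus_cancel K)
        also have "\<dots> \<le> (C * r ^ N) * K" using C K0 by (intro mult_right_mono) auto
        finally show ?thesis by (simp add: mult_ac)
      qed
      then show ?thesis by blast
    qed
  qed
  obtain p where "p \<noteq> 0" "poly_action B p v = 0" by (rule annihilating_poly)
  with main show ?thesis by blast
qed

section \<open>Evaluation of polynomials\<close>

definition monomial_value :: "('m::finite \<Rightarrow>\<^sub>0 nat) \<Rightarrow> complex ^ 'm \<Rightarrow> complex" where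
  "monomial_value m x = (\<Prod>j\<in>UNIV. x $ j ^ Poly_Mapping.lookup m j)"

lemma peval_superset:
  assumes "finite S" "Poly_Mapping.keys p \<subseteq> S"
  shows "peval p x = (\<Sum>m\<in>S. Poly_Mapping.lookup p m * monomial_value m x)"
  unfolding peval_def monomial_value_def
  by (rule sum.mono_neutral_left) (use assms in \<open>auto simp: in_keys_iff\<close>)

lemma monomial_value_add: "monomial_value (a + b) x = monomial_value a x * monomial_value b x"
  by (simp add: monomial_value_def lookup_add power_add prod.distrib)

lemma peval_single [simp]: "peval (Poly_Mapping.single m c) x = c * monomial_value m x"
  by (subst peval_superset[of "{m}"]) (auto split: if_splits)

lemma peval_add: "peval (p + q) x = peval p x + peval q x"
proof -
  let ?S = "Poly_Mapping.keys p \<union> Poly_Mapping.keys q"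
  show ?thesis
    by (simp add: peval_superset[of ?S] Poly_Mapping.keys_add lookup_add distrib_right sum.distrib)
qed

lemma peval_diff: "peval (p - q) x = peval p x - peval q x"
  using peval_add[of "p - q" q x] by simp

lemma peval_zero [simp]: "peval 0 x = 0"
  by (simp add: peval_def)

lemma peval_sum: "peval (\<Sum>i\<in>I. f i) x = (\<Sum>i\<in>I. peval (f i) x)"
  by (induction I rule: infinite_finite_induct) (simp_all add: peval_add)

lemma sum_of_monomials:
  "p = (\<Sum>m\<in>Poly_Mapping.keys p. Poly_Mapping.single m (Poly_Mapping.lookup p m))"
  by (rule poly_mapping_eqI)
     (auto simp: lookup_sum lookup_single when_def in_keys_iff if_distrib cong: if_cong)

lemma peval_mult: "peval (p * q) x = peval p x * peval q x"
proof -
  have "p * q = (\<Sum>a\<in>Poly_Mapping.keys p. \<Sum>b\<in>Poly_Mapping.keys q.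
      Poly_Mapping.single (a + b) (Poly_Mapping.lookup p a * Poly_Mapping.lookup q b))"
    by (subst sum_of_monomials[of p], subst sum_of_monomials[of q])
       (simp add: sum_distrib_left sum_distrib_right mult_single sum.swap[of _ "Poly_Mapping.keys q"])
  then have "peval (p * q) x = (\<Sum>a\<in>Poly_Mapping.keys p. \<Sum>b\<in>Poly_Mapping.keys q.
      (Poly_Mapping.lookup p a * monomial_value a x) * (Poly_Mapping.lookup q b * monomial_value b x))"
    by (simp add: peval_sum monomial_value_add mult_ac)
  also have "\<dots> = peval p x * peval q x"
    by (simp add: peval_def monomial_value_def sum_product)
  finally show ?thesis .
qed

section \<open>Polynomials that vanish on the torus\<close>

definition torus :: "(complex ^ 'm) set" where
  "torus = {x. \<forall>j. x $ j \<noteq> 0}"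

text \<open>A polynomial that vanishes at all nonzero \<open>t\<close> has infinitely many roots, so it is zero.\<close>
lemma exponential_sum_coefficient_0:
  fixes c :: "'a \<Rightarrow> complex"
  assumes "finite S" and "\<And>t. t \<noteq> 0 \<Longrightarrow> (\<Sum>m\<in>S. c m * t ^ e m) = 0"
  shows "(\<Sum>m | m \<in> S \<and> e m = k. c m) = 0"
proof -
  define p where "p = (\<Sum>m\<in>S. monom (c m) (e m))"
  have "p = 0"
  proof (rule ccontr)
    assume "p \<noteq> 0"
    then have "finite {t. poly p t = 0}" by (rule poly_roots_finite)
    moreover have "- {0} \<subseteq> {t. poly p t = 0}"
      using assms(2) by (auto simp: p_def poly_sum poly_monom)
    ultimately have "finite (UNIV :: complex set)"
      by (metis Compl_eq_Diff_UNIV finite_Diff2 finite.emptyI finite_insert finite_subset)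
    then show False using infinite_UNIV_char_0 by blast
  qed
  then have "0 = coeff p k" by simp
  also have "\<dots> = (\<Sum>m\<in>S. if e m = k then c m else 0)" by (simp add: p_def coeff_sum)
  also have "\<dots> = (\<Sum>m | m \<in> S \<and> e m = k. c m)"
    by (rule sum.inter_filter[symmetric]) (rule assms(1))
  finally show ?thesis by simp
qed

text \<open>The variables are separated one after the other: with the others fixed, the sum is a polynomial in one
variable, and each of its coefficients is a sum of the same kind over the exponent vectors that agree
with \<open>a\<close> in that variable.\<close>
lemma vanishing_on_torus_partial:
  fixes c :: "('m::finite \<Rightarrow>\<^sub>0 nat) \<Rightarrow> complex"
  assumes "finite J" "finite S"
    and "\<And>x :: complex ^ 'm. x \<in> torus \<Longrightarrow> (\<Sum>m\<in>S. c m * (\<Prod>j\<in>J. x $ j ^ Poly_Mapping.lookup m j)) = 0"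
  shows "(\<Sum>m | m \<in> S \<and> (\<forall>j\<in>J. Poly_Mapping.lookup m j = Poly_Mapping.lookup a j). c m) = 0"
  using assms
proof (induction J arbitrary: S rule: finite_induct)
  case empty
  have "(\<chi> j. 1) \<in> (torus :: (complex ^ 'm) set)" by (simp add: torus_def)
  from empty.prems(2)[OF this] show ?case by simp
next
  case (insert k J)
  define S' where "S' = {m \<in> S. Poly_Mapping.lookup m k = Poly_Mapping.lookup a k}"
  have "(\<Sum>m | m \<in> S' \<and> (\<forall>j\<in>J. Poly_Mapping.lookup m j = Poly_Mapping.lookup a j). c m) = 0"
  proof (rule insert.IH)
    show "finite S'" using insert.prems by (simp add: S'_def)
    fix x :: "complex ^ 'm" assume x: "x \<in> torus"
    define w where "w m = c m * (\<Prod>j\<in>J. x $ j ^ Poly_Mapping.lookup m j)" for m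
    have "(\<Sum>m | m \<in> S \<and> Poly_Mapping.lookup m k = Poly_Mapping.lookup a k. w m) = 0"
    proof (rule exponential_sum_coefficient_0[OF insert.prems(1)])
      fix t :: complex assume t: "t \<noteq> 0"
      define y where "y = (\<chi> j. if j = k then t else x $ j)"
      have "y \<in> torus" using x t by (simp add: torus_def y_def)
      have "w m * t ^ Poly_Mapping.lookup m k
          = c m * (\<Prod>j\<in>insert k J. y $ j ^ Poly_Mapping.lookup m j)" for m
      proof -
        have "(\<Prod>j\<in>J. y $ j ^ Poly_Mapping.lookup m j) = (\<Prod>j\<in>J. x $ j ^ Poly_Mapping.lookup m j)"
          using insert.hyps by (intro prod.cong) (auto simp: y_def)
        then show ?thesis using insert.hyps by (simp add: y_def w_def)
      qed
      then show "(\<Sum>m\<in>S. w m * t ^ Poly_Mapping.lookup m k) = 0"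
        using insert.prems(2)[OF \<open>y \<in> torus\<close>] by simp
    qed
    then show "(\<Sum>m\<in>S'. c m * (\<Prod>j\<in>J. x $ j ^ Poly_Mapping.lookup m j)) = 0"
      by (simp add: w_def S'_def)
  qed
  also have "{m. m \<in> S' \<and> (\<forall>j\<in>J. Poly_Mapping.lookup m j = Poly_Mapping.lookup a j)}
      = {m. m \<in> S \<and> (\<forall>j\<in>insert k J. Poly_Mapping.lookup m j = Poly_Mapping.lookup a j)}"
    by (auto simp: S'_def)
  finally show ?case .
qed

lemma vanishing_on_torus:
  fixes p :: "'m::finite cpoly"
  assumes "\<And>x. x \<in> torus \<Longrightarrow> peval p x = 0"
  shows "p = 0"
proof (rule poly_mapping_eqI)
  fix a
  have eq: "(\<forall>j. Poly_Mapping.lookup m j = Poly_Mapping.lookup a j) \<longleftrightarrow> m = a" for m :: "'m \<Rightarrow>\<^sub>0 nat"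
    by (auto intro: poly_mapping_eqI)
  have "(\<Sum>m | m \<in> Poly_Mapping.keys p \<and> (\<forall>j\<in>UNIV. Poly_Mapping.lookup m j = Poly_Mapping.lookup a j).
      Poly_Mapping.lookup p m) = 0"
    by (rule vanishing_on_torus_partial) (use assms in \<open>auto simp: peval_def\<close>)
  also have "{m. m \<in> Poly_Mapping.keys p \<and> (\<forall>j\<in>UNIV. Poly_Mapping.lookup m j = Poly_Mapping.lookup a j)}
      = (if a \<in> Poly_Mapping.keys p then {a} else {})"
    by (auto simp: eq)
  finally show "Poly_Mapping.lookup p a = Poly_Mapping.lookup 0 a"
    by (auto simp: in_keys_iff split: if_splits)
qed

section \<open>Homogeneous polynomials and projective points\<close>

lemma peval_scale:
  assumes "homogeneous d p"
  shows "peval p (c *s x) = c ^ d * peval p x"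
  unfolding peval_def sum_distrib_left
proof (rule sum.cong)
  fix m assume "m \<in> Poly_Mapping.keys p"
  then have "(\<Sum>j\<in>UNIV. Poly_Mapping.lookup m j) = d" using assms by (simp add: homogeneous_def)
  then have "(\<Prod>j\<in>UNIV. c ^ Poly_Mapping.lookup m j) = c ^ d" by (simp flip: power_sum)
  then show "Poly_Mapping.lookup p m * (\<Prod>j\<in>UNIV. (c *s x) $ j ^ Poly_Mapping.lookup m j) =
      c ^ d * (Poly_Mapping.lookup p m * (\<Prod>j\<in>UNIV. x $ j ^ Poly_Mapping.lookup m j))"
    by (simp add: power_mult_distrib prod.distrib)
qed simp

lemma rep_abs_cproj:
  assumes "x \<noteq> 0"
  obtains c where "c \<noteq> 0" "rep_cproj (abs_cproj x) = c *s x"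
proof -
  have "proj_rel x x" using assms by (auto simp: proj_rel_def intro: exI[of _ 1])
  then have "proj_rel (rep_cproj (abs_cproj x)) x"
    using Quotient3_cproj Quotient3_rep_abs by metis
  then have "proj_rel x (rep_cproj (abs_cproj x))"
    using part_equivp_symp[OF part_equivp_proj_rel] by metis
  then show thesis using that by (auto simp: proj_rel_def)
qed

lemma abs_cproj_eqI:
  assumes "x \<noteq> 0" "c \<noteq> 0"
  shows "abs_cproj (c *s x) = abs_cproj x"
proof -
  have "proj_rel x (c *s x)" using assms by (auto simp: proj_rel_def)
  then show ?thesis using Quotient3_rel_abs[OF Quotient3_cproj] by metis
qed

lemma abs_cproj_eqD:
  assumes "x \<noteq> 0" "y \<noteq> 0" "abs_cproj x = abs_cproj y"
  obtains c where "y = c *s x"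
proof -
  have "proj_rel x x" "proj_rel y y" using assms by (auto simp: proj_rel_def intro: exI[of _ 1])
  with assms have "proj_rel x y" using Quotient3_rel[OF Quotient3_cproj, of x y] by metis
  then show thesis using that by (auto simp: proj_rel_def)
qed

lemma abs_rep_cproj: "abs_cproj (rep_cproj \<xi>) = \<xi>"
  by (rule Quotient3_abs_rep[OF Quotient3_cproj])

lemma torus_nonzero: "x \<in> torus \<Longrightarrow> x \<noteq> (0 :: complex ^ 'm)"
  by (auto simp: torus_def vec_eq_iff)

lemma torus_scale: "x \<in> torus \<Longrightarrow> c \<noteq> 0 \<Longrightarrow> c *s x \<in> torus"
  by (simp add: torus_def)

lemma zariski_dense_torus:
  assumes "\<And>\<xi>. rep_cproj \<xi> \<in> torus \<Longrightarrow> \<xi> \<in> S"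
  shows "zariski_dense S"
  unfolding zariski_dense_def
proof (intro allI impI, elim conjE)
  fix d and h :: "'a cpoly"
  assume h: "homogeneous d h" and z: "\<forall>\<xi>\<in>S. peval h (rep_cproj \<xi>) = 0"
  show "h = 0"
  proof (rule vanishing_on_torus)
    fix x :: "complex ^ 'a" assume x: "x \<in> torus"
    obtain c where c: "c \<noteq> 0" "rep_cproj (abs_cproj x) = c *s x"
      by (rule rep_abs_cproj[OF torus_nonzero[OF x]])
    then have "abs_cproj x \<in> S" using assms torus_scale[OF x] by simp
    then have "peval h (c *s x) = 0" using z c by fastforce
    then show "peval h x = 0" using c by (simp add: peval_scale[OF h])
  qed
qed

lemma pvar_power: "pvar j ^ n = Poly_Mapping.single (Poly_Mapping.single j n) 1"
proof (induction n)
  case (Suc n)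
  then show ?case by (simp add: pvar_def mult_single flip: single_add)
qed simp

lemma homogeneous_mult:
  assumes "homogeneous d p" "homogeneous e q"
  shows "homogeneous (d + e) (p * q)"
  unfolding homogeneous_def
proof
  fix m assume "m \<in> Poly_Mapping.keys (p * q)"
  then obtain a b where "m = a + b" "a \<in> Poly_Mapping.keys p" "b \<in> Poly_Mapping.keys q"
    using keys_mult[of p q] by blast
  then show "(\<Sum>j\<in>UNIV. Poly_Mapping.lookup m j) = d + e"
    using assms by (simp add: homogeneous_def lookup_add sum.distrib)
qed

lemma homogeneous_diff:
  assumes "homogeneous d p" "homogeneous d q"
  shows "homogeneous d (p - q)"
  unfolding homogeneous_def
proof
  fix m assume "m \<in> Poly_Mapping.keys (p - q)"
  then have "m \<in> Poly_Mapping.keys p \<or> m \<in> Poly_Mapping.keys q"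
    by (auto simp: in_keys_iff lookup_minus)
  with assms show "(\<Sum>j\<in>UNIV. Poly_Mapping.lookup m j) = d" by (auto simp: homogeneous_def)
qed

lemma homogeneous_single: "homogeneous (\<Sum>j\<in>UNIV. Poly_Mapping.lookup m j) (Poly_Mapping.single m c)"
  by (simp add: homogeneous_def)

text \<open>If \<open>h\<close> vanishes on the part of \<open>S\<close> inside the torus, then \<open>h\<close> times the product of all coordinates
vanishes on \<open>S\<close>. Two Zariski dense sets may be disjoint; it matters that the torus is also open.\<close>
lemma zariski_dense_inter_torus:
  assumes S: "zariski_dense (S :: 'm::finite cproj set)"
  shows "zariski_dense {\<xi> \<in> S. rep_cproj \<xi> \<in> torus}"
  unfolding zariski_dense_def
proof (intro allI impI, elim conjE)
  fix d and h :: "'m cpoly"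
  assume h: "homogeneous d h" and z: "\<forall>\<xi>\<in>{\<xi> \<in> S. rep_cproj \<xi> \<in> torus}. peval h (rep_cproj \<xi>) = 0"
  \<comment> \<open>The exponent vector of the product of all coordinates.\<close>
  define v :: "'m \<Rightarrow>\<^sub>0 nat" where "v = (\<Sum>j\<in>UNIV. Poly_Mapping.single j 1)"
  have v: "Poly_Mapping.lookup v j = 1" for j
    by (simp add: v_def lookup_sum lookup_single when_def)
  have "peval (h * Poly_Mapping.single v 1) (rep_cproj \<xi>) = 0" if "\<xi> \<in> S" for \<xi>
    using z that by (cases "rep_cproj \<xi> \<in> torus") (auto simp: peval_mult monomial_value_def torus_def v)
  then have "h * Poly_Mapping.single v 1 = 0"
    using S homogeneous_mult[OF h homogeneous_single] unfolding zariski_dense_def by blast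
  then have "peval (h * Poly_Mapping.single v 1) x = 0" for x by simp
  then show "h = 0"
    by (intro vanishing_on_torus) (auto simp: peval_mult monomial_value_def torus_def v)
qed

section \<open>Divisors of monomials\<close>

lemma restriction_to_coordinate:
  obtains r where "\<And>t. poly r t = peval p (\<chi> i. if i = j then t else x $ i)"
proof
  fix t
  have prod: "(\<Prod>i\<in>UNIV. (if i = j then t else x $ i) ^ Poly_Mapping.lookup m i)
      = (\<Prod>i\<in>UNIV - {j}. x $ i ^ Poly_Mapping.lookup m i) * t ^ Poly_Mapping.lookup m j" for m
    by (subst prod.remove[of UNIV j]) (auto intro: prod.cong)
  show "poly (\<Sum>m\<in>Poly_Mapping.keys p. monom (Poly_Mapping.lookup p m *
        (\<Prod>i\<in>UNIV - {j}. x $ i ^ Poly_Mapping.lookup m i)) (Poly_Mapping.lookup m j)) t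
      = peval p (\<chi> i. if i = j then t else x $ i)"
    by (simp add: peval_def prod poly_sum poly_monom mult_ac)
qed

text \<open>A divisor \<open>h\<close> of a monomial has no zeros on the torus. Fix all variables but \<open>j\<close>, and choose a monomial
not involving \<open>x\<^sub>j\<close>: then \<open>h\<close> and its cofactor restrict to univariate polynomials with constant product,
so \<open>h\<close> does not depend on \<open>x\<^sub>j\<close>. Changing one coordinate after the other shows that \<open>h\<close> is constant on
the torus.\<close>
lemma dvd_monomials_imp_constant:
  fixes m :: "'i \<Rightarrow> ('m::finite \<Rightarrow>\<^sub>0 nat)"
  assumes h: "\<And>i. h dvd Poly_Mapping.single (m i) 1"
    and min: "\<And>j. \<exists>i. Poly_Mapping.lookup (m i) j = 0"
  obtains c where "c \<noteq> 0" "h = Poly_Mapping.single 0 (c :: complex)"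
proof -
  obtain g where g: "\<And>i. Poly_Mapping.single (m i) 1 = h * g i"
    using h unfolding dvd_def by metis
  have hg: "peval h x * peval (g i) x = monomial_value (m i) x" for i x
    by (simp flip: peval_mult g)
  have nz: "peval h x \<noteq> 0" if "x \<in> torus" for x
    using hg[of x] that by (force simp: monomial_value_def torus_def)
  have indep: "peval h (\<chi> i. if i = j then t else x $ i) = peval h x" if x: "x \<in> torus" for x j t
  proof -
    obtain i where i: "Poly_Mapping.lookup (m i) j = 0" using min by blast
    obtain r where r: "\<And>t. poly r t = peval h (\<chi> i. if i = j then t else x $ i)"
      using restriction_to_coordinate[of h j x] by blast
    obtain s where s: "\<And>t. poly s t = peval (g i) (\<chi> i. if i = j then t else x $ i)"
      using restriction_to_coordinate[of "g i" j x] by blast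
    have val: "monomial_value (m i) (\<chi> k. if k = j then t else x $ k) = monomial_value (m i) x" for t
      unfolding monomial_value_def by (rule prod.cong) (use i in auto)
    have "poly (r * s) t = poly [:monomial_value (m i) x:] t" for t
      by (simp add: r s hg val)
    then have rs: "r * s = [:monomial_value (m i) x:]" by (intro poly_ext)
    have "monomial_value (m i) x \<noteq> 0" using x by (simp add: monomial_value_def torus_def)
    then have "r \<noteq> 0" "s \<noteq> 0" "degree (r * s) = 0" using rs by auto
    then have "degree r = 0" by (simp add: degree_mult_eq)
    then have "poly r t = poly r (x $ j)" by (metis degree_0_id poly_const_conv)
    moreover have "(\<chi> i. if i = j then x $ j else x $ i) = x" by (simp add: vec_eq_iff)
    ultimately show ?thesis by (simp add: r)
  qed
  have "peval h (\<chi> j. if j \<in> J then x $ j else 1) = peval h (\<chi> j. 1)"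
    if x: "x \<in> torus" and "finite J" for x J
    using that(2)
  proof (induction J rule: finite_induct)
    case (insert k J)
    define y where "y = (\<chi> j. if j \<in> J then x $ j else 1)"
    have "y \<in> torus" using x by (simp add: y_def torus_def)
    moreover have "(\<chi> j. if j \<in> insert k J then x $ j else 1) = (\<chi> j. if j = k then x $ k else y $ j)"
      by (auto simp: y_def vec_eq_iff)
    ultimately show ?case using indep[of y k "x $ k"] insert by (simp add: y_def)
  qed simp
  from this[of _ UNIV] have const: "x \<in> torus \<Longrightarrow> peval h x = peval h (\<chi> j. 1)" for x by simp
  define c where "c = peval h (\<chi> j. 1)"
  have "h - Poly_Mapping.single 0 c = 0"
    by (rule vanishing_on_torus) (simp add: peval_diff const c_def monomial_value_def)
  moreover have "c \<noteq> 0" unfolding c_def by (rule nz) (simp add: torus_def)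
  ultimately show thesis using that by simp
qed

lemma mult_monomial_cancel:
  fixes p :: "'m::finite cpoly"
  assumes "p * Poly_Mapping.single m 1 = q * Poly_Mapping.single m 1"
  shows "p = q"
proof -
  have "p - q = 0"
  proof (rule vanishing_on_torus)
    fix x :: "complex ^ 'm" assume "x \<in> torus"
    then have "monomial_value m x \<noteq> 0" by (simp add: monomial_value_def torus_def)
    then show "peval (p - q) x = 0"
      using arg_cong[OF assms, of "\<lambda>f. peval f x"] by (simp add: peval_diff peval_mult)
  qed
  then show ?thesis by simp
qed

lemma lookup_times_monomial:
  fixes p :: "'m cpoly"
  shows "Poly_Mapping.lookup (p * Poly_Mapping.single b 1) (a + b) = Poly_Mapping.lookup p a"
proof -
  have "p * Poly_Mapping.single b 1
      = (\<Sum>m\<in>Poly_Mapping.keys p. Poly_Mapping.single (m + b) (Poly_Mapping.lookup p m))"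
    by (subst sum_of_monomials[of p]) (simp add: sum_distrib_right mult_single)
  then show ?thesis
    by (auto simp: lookup_sum lookup_single when_def in_keys_iff if_distrib cong: if_cong)
qed

text \<open>Reduced forms that are proportional to monomials have the degree of these monomials. For each variable
some \<open>m k\<close> does not involve it, so comparing exponents in the proportionality relation shows that
\<open>m i\<close> divides every term of \<open>P i\<close>. The quotient does not depend on \<open>i\<close>; hence it is a common factor of
all \<open>P i\<close>, and so a constant.\<close>
lemma monomials_proportional_degree:
  fixes m :: "'i \<Rightarrow> ('m::finite \<Rightarrow>\<^sub>0 nat)" and P :: "'i \<Rightarrow> 'm cpoly"
  assumes min: "\<And>j. \<exists>i. Poly_Mapping.lookup (m i) j = 0"
    and deg: "\<And>i. (\<Sum>j\<in>UNIV. Poly_Mapping.lookup (m i) j) = D"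
    and hom: "\<And>i. homogeneous d (P i)"
    and ncf: "\<And>h. (\<And>i. h dvd P i) \<Longrightarrow> h dvd 1"
    and cross: "\<And>i k. P i * Poly_Mapping.single (m k) 1 = P k * Poly_Mapping.single (m i) 1"
  shows "d = D"
proof -
  have le: "Poly_Mapping.lookup (m i) j \<le> Poly_Mapping.lookup a j"
    if a: "a \<in> Poly_Mapping.keys (P i)" for a i j
  proof -
    obtain k where k: "Poly_Mapping.lookup (m k) j = 0" using min by blast
    have "a + m k \<in> Poly_Mapping.keys (P i * Poly_Mapping.single (m k) 1)"
      using a by (simp add: in_keys_iff lookup_times_monomial)
    then have "a + m k \<in> Poly_Mapping.keys (P k * Poly_Mapping.single (m i) 1)"
      by (simp only: cross)
    then obtain b where "a + m k = b + m i"
      using keys_mult[of "P k" "Poly_Mapping.single (m i) 1"] by auto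
    from arg_cong[OF this, of "\<lambda>f. Poly_Mapping.lookup f j"] k show ?thesis
      by (simp add: lookup_add)
  qed
  define H where "H i = (\<Sum>a\<in>Poly_Mapping.keys (P i).
      Poly_Mapping.single (a - m i) (Poly_Mapping.lookup (P i) a))" for i
  have PH: "P i = H i * Poly_Mapping.single (m i) 1" for i
  proof -
    have "a - m i + m i = a" if "a \<in> Poly_Mapping.keys (P i)" for a
      using le[OF that] by (intro poly_mapping_eqI) (simp add: lookup_add minus_poly_mapping.rep_eq)
    then have "H i * Poly_Mapping.single (m i) 1
        = (\<Sum>a\<in>Poly_Mapping.keys (P i). Poly_Mapping.single a (Poly_Mapping.lookup (P i) a))"
      by (simp add: H_def sum_distrib_right mult_single)
    then show ?thesis using sum_of_monomials[of "P i"] by simp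
  qed
  have HH: "H i = H k" for i k
  proof (rule mult_monomial_cancel)
    show "H i * Poly_Mapping.single (m i + m k) 1 = H k * Poly_Mapping.single (m i + m k) 1"
      using cross[of i k] unfolding PH[of i] PH[of k] by (simp add: mult.assoc mult_single add.commute)
  qed
  define i :: 'i where "i = undefined"
  have "H i dvd P k" for k using PH[of k] HH[of i k] by (metis dvd_triv_left)
  then have "H i dvd 1" by (rule ncf)
  then have "H i dvd Poly_Mapping.single 0 1" by simp
  then obtain c where c: "c \<noteq> 0" "H i = Poly_Mapping.single 0 c"
    using dvd_monomials_imp_constant[of "H i" "\<lambda>_::unit. 0"] by (metis lookup_zero)
  \<comment> \<open>Scaling a point by 2 multiplies \<open>P i\<close> by \<open>2\<^sup>d\<close> and the monomial by \<open>2\<^sup>D\<close>.\<close>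
  define x :: "complex ^ 'm" where "x = (\<chi> j. 1)"
  have val: "monomial_value (m i) (2 *s x) = 2 ^ D" "monomial_value (m i) x = 1"
    by (simp_all add: monomial_value_def x_def flip: power_sum deg[of i])
  have "peval (P i) (2 *s x) = 2 ^ d * peval (P i) x" by (rule peval_scale[OF hom])
  then have "(2::complex) ^ D = 2 ^ d"
    using c val by (simp add: PH[of i] peval_mult monomial_value_def)
  then have "norm ((2::complex) ^ D) = norm ((2::complex) ^ d)" by simp
  then show ?thesis by (simp add: norm_power)
qed

section \<open>Monomial maps on the torus\<close>

lemma power_int_sum:
  fixes x :: "'a::field"
  assumes "x \<noteq> 0"
  shows "x powi (\<Sum>i\<in>I. f i) = (\<Prod>i\<in>I. x powi f i)"
  by (induction I rule: infinite_finite_induct) (simp_all add: assms power_int_add)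

lemma prod_power_int:
  fixes f :: "'b \<Rightarrow> 'a::field"
  shows "(\<Prod>i\<in>I. f i) powi k = (\<Prod>i\<in>I. f i powi k)"
  by (induction I rule: infinite_finite_induct) (simp_all add: power_int_mult_distrib)

text \<open>The monomial map before denominators are cleared. On the torus it represents the same map, up to
scalars.\<close>
definition laurent_map :: "int ^ 'n ^ 'n \<Rightarrow> complex ^ 'n option \<Rightarrow> complex ^ 'n option" where
  "laurent_map B x = (\<chi> i. \<Prod>j\<in>UNIV. x $ j powi laurent_exponent B i j)"

lemma sum_option: "(\<Sum>j\<in>(UNIV :: 'n::finite option set). f j) = f None + (\<Sum>j\<in>UNIV. f (Some j))"
  by (simp add: UNIV_option_conv sum.reindex)

text \<open>All components are homogeneous of degree 0; this makes the Laurent map invariant under scaling.\<close>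
lemma laurent_exponent_row_sum: "(\<Sum>j\<in>UNIV. laurent_exponent B i j) = 0"
  by (cases i) (simp_all add: sum_option)

lemma laurent_exponent_mult:
  "laurent_exponent (A ** B) i j = (\<Sum>k\<in>UNIV. laurent_exponent A i k * laurent_exponent B k j)"
proof (cases i)
  case (Some a)
  show ?thesis
  proof (cases j)
    case None
    show ?thesis unfolding Some None
      by (simp add: sum_option matrix_matrix_mult_def sum_distrib_left sum_negf
          sum.swap[of "\<lambda>l k. A $ a $ k * B $ k $ l"])
  qed (simp add: Some sum_option matrix_matrix_mult_def)
qed simp

lemma laurent_map_torus: "x \<in> torus \<Longrightarrow> laurent_map B x \<in> torus"
  by (simp add: torus_def laurent_map_def)

lemma laurent_map_scale:
  assumes "c \<noteq> 0"
  shows "laurent_map B (c *s x) = laurent_map B x"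
proof -
  have "(\<Prod>j\<in>UNIV. c powi laurent_exponent B i j) = 1" for i
    using power_int_sum[OF assms, of "laurent_exponent B i" UNIV] by (simp add: laurent_exponent_row_sum)
  then show ?thesis
    by (simp add: vec_eq_iff laurent_map_def power_int_mult_distrib prod.distrib)
qed

lemma laurent_map_compose:
  assumes "x \<in> torus"
  shows "laurent_map A (laurent_map B x) = laurent_map (A ** B) x"
proof -
  have "(\<Prod>k\<in>UNIV. (\<Prod>j\<in>UNIV. x $ j powi laurent_exponent B k j) powi laurent_exponent A i k)
      = (\<Prod>j\<in>UNIV. \<Prod>k\<in>UNIV. x $ j powi (laurent_exponent A i k * laurent_exponent B k j))" for i
    by (subst prod.swap) (simp add: prod_power_int mult.commute flip: power_int_mult)
  also have "\<dots> i = (\<Prod>j\<in>UNIV. x $ j powi laurent_exponent (A ** B) i j)" for i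
    using assms by (simp add: laurent_exponent_mult power_int_sum torus_def)
  finally show ?thesis by (simp add: laurent_map_def vec_eq_iff)
qed

lemma laurent_map_identity:
  assumes "x \<in> torus"
  shows "laurent_map (mat 1) x = inverse (x $ None) *s x"
proof -
  have "laurent_map (mat 1) x $ i = inverse (x $ None) * x $ i" for i
  proof (cases i)
    case None
    then show ?thesis using assms by (simp add: laurent_map_def torus_def)
  next
    case (Some a)
    have "(\<Sum>j\<in>UNIV. (mat 1 :: int ^ 'a ^ 'a) $ a $ j) = 1" by (simp add: mat_def)
    moreover have "(\<Prod>j\<in>UNIV. x $ Some j powi (mat 1 :: int ^ 'a ^ 'a) $ a $ j) = x $ Some a"
    proof -
      have "(\<Prod>j\<in>UNIV. x $ Some j powi (mat 1 :: int ^ 'a ^ 'a) $ a $ j)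
          = (\<Prod>j\<in>UNIV. if j = a then x $ Some a else 1)"
        by (rule prod.cong) (auto simp: mat_def)
      then show ?thesis by simp
    qed
    ultimately show ?thesis
      using Some by (simp add: laurent_map_def UNIV_option_conv prod.reindex power_int_minus)
  qed
  then show ?thesis by (simp add: vec_eq_iff)
qed

definition exponent_vector :: "int ^ 'n ^ 'n \<Rightarrow> 'n option \<Rightarrow> ('n option \<Rightarrow>\<^sub>0 nat)" where
  "exponent_vector B i = (\<Sum>j\<in>UNIV. Poly_Mapping.single j (monomial_exponent B i j))"

lemma lookup_exponent_vector [simp]:
  "Poly_Mapping.lookup (exponent_vector B i) j = monomial_exponent B i j"
  by (simp add: exponent_vector_def lookup_sum lookup_single when_def)

lemma monomial_component_eq: "monomial_component B i = Poly_Mapping.single (exponent_vector B i) 1"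
proof -
  have "(\<Prod>j\<in>J. pvar j ^ monomial_exponent B i j)
      = Poly_Mapping.single (\<Sum>j\<in>J. Poly_Mapping.single j (monomial_exponent B i j)) 1" for J
    by (induction J rule: infinite_finite_induct) (simp_all add: pvar_power mult_single)
  then show ?thesis by (simp add: monomial_component_def exponent_vector_def)
qed

definition least_exponent :: "int ^ 'n ^ 'n \<Rightarrow> 'n option \<Rightarrow> int" where
  "least_exponent B j = Min (range (\<lambda>k. laurent_exponent B k j))"

lemma least_exponent_le: "least_exponent B j \<le> laurent_exponent B k j"
  by (simp add: least_exponent_def)

lemma least_exponent_le_0: "least_exponent B j \<le> 0"
  using least_exponent_le[of B j None] by simp

lemma int_monomial_exponent: "int (monomial_exponent B i j) = laurent_exponent B i j - least_exponent B j"
  using least_exponent_le[of B j i] by (simp add: monomial_exponent_def least_exponent_def)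

text \<open>Each component of the Laurent map has degree 0 by \<open>laurent_exponent_row_sum\<close>, so after the least
exponents are subtracted the degree is minus their total, the same for all components.\<close>
definition laurent_degree :: "int ^ 'n ^ 'n \<Rightarrow> nat" where
  "laurent_degree B = nat (\<Sum>j\<in>UNIV. - least_exponent B j)"

lemma int_laurent_degree: "int (laurent_degree B) = (\<Sum>j\<in>UNIV. - least_exponent B j)"
proof -
  have "0 \<le> (\<Sum>j\<in>UNIV. - least_exponent B j)"
    by (rule sum_nonneg) (simp add: least_exponent_le_0)
  then show ?thesis by (simp add: laurent_degree_def)
qed

lemma exponent_vector_degree: "(\<Sum>j\<in>UNIV. Poly_Mapping.lookup (exponent_vector B i) j) = laurent_degree B"
proof -
  have "int (\<Sum>j\<in>UNIV. monomial_exponent B i j) = int (laurent_degree B)"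
    by (simp add: int_monomial_exponent sum_subtractf laurent_exponent_row_sum int_laurent_degree sum_negf)
  then show ?thesis by (simp only: of_nat_eq_iff lookup_exponent_vector)
qed

lemma exponent_vector_min: "\<exists>i. Poly_Mapping.lookup (exponent_vector B i) j = 0"
proof -
  have "least_exponent B j \<in> range (\<lambda>k. laurent_exponent B k j)"
    unfolding least_exponent_def by (rule Min_in) auto
  then obtain i where "least_exponent B j = laurent_exponent B i j" by auto
  then show ?thesis by (auto intro!: exI[of _ i] simp: monomial_exponent_def least_exponent_def)
qed

lemma components_eq_multiple_laurent_map:
  assumes x: "x \<in> torus"
  obtains c where "c \<noteq> 0" "(\<chi> i. peval (monomial_component B i) x) = c *s laurent_map B x"
proof
  define c where "c = (\<Prod>j\<in>UNIV. x $ j powi (- least_exponent B j))"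
  show "c \<noteq> 0" using x by (simp add: c_def torus_def)
  have "x $ j ^ monomial_exponent B i j = x $ j powi (- least_exponent B j) * x $ j powi laurent_exponent B i j" for i j
    using x by (simp add: torus_def int_monomial_exponent flip: power_int_of_nat power_int_add)
  then show "(\<chi> i. peval (monomial_component B i) x) = c *s laurent_map B x"
    by (simp add: vec_eq_iff monomial_component_eq monomial_value_def laurent_map_def c_def prod.distrib)
qed

lemma poly_map_component_torus:
  assumes x: "x \<in> torus"
  shows "poly_map (monomial_component B) (abs_cproj x) = Some (abs_cproj (laurent_map B x))"
proof -
  obtain c where c: "c \<noteq> 0" "rep_cproj (abs_cproj x) = c *s x"
    by (rule rep_abs_cproj[OF torus_nonzero[OF x]])
  obtain e where e: "e \<noteq> 0" "(\<chi> i. peval (monomial_component B i) (c *s x)) = e *s laurent_map B (c *s x)"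
    by (rule components_eq_multiple_laurent_map[OF torus_scale[OF x c(1)]])
  have t: "laurent_map B x \<in> torus" using x by (rule laurent_map_torus)
  have "e *s laurent_map B x \<noteq> 0" using torus_nonzero[OF torus_scale[OF t e(1)]] .
  then show ?thesis
    using abs_cproj_eqI[OF torus_nonzero[OF t] e(1)]
    by (simp add: poly_map_def c e(2) laurent_map_scale[OF c(1)])
qed

primrec mat_power :: "int ^ 'n ^ 'n \<Rightarrow> nat \<Rightarrow> int ^ 'n ^ 'n" where
  "mat_power A 0 = mat 1"
| "mat_power A (Suc N) = A ** mat_power A N"

lemma map_iter_torus:
  assumes x: "x \<in> torus"
  shows "map_iter (monomial_map A) N (abs_cproj x) = Some (abs_cproj (laurent_map (mat_power A N) x))"
proof (induction N)
  case 0
  have "x $ None \<noteq> 0" using x by (simp add: torus_def)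
  then show ?case
    using abs_cproj_eqI[OF torus_nonzero[OF x], of "inverse (x $ None)"] laurent_map_identity[OF x] by simp
next
  case (Suc N)
  then show ?case
    using poly_map_component_torus[OF laurent_map_torus[OF x]] laurent_map_compose[OF x]
    by (simp add: map_comp_def monomial_map_def)
qed

section \<open>The degree of an iterate\<close>

text \<open>The definite description in \<open>map_degree\<close> is determined already by the values on the torus. For another
reduced form \<open>P\<close>, the polynomials \<open>P\<^sub>i M\<^sub>k - P\<^sub>k M\<^sub>i\<close> vanish on a Zariski dense subset of the torus,
where both forms represent the same point.\<close>
lemma map_degree_eq:
  assumes g: "\<And>x. x \<in> torus \<Longrightarrow> g (abs_cproj x) = Some (abs_cproj (laurent_map B x))"
  shows "map_degree g = laurent_degree B"
  unfolding map_degree_def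
proof (rule the_equality)
  have gr: "g \<xi> = poly_map (monomial_component B) \<xi>" "\<xi> \<in> dom g" if "rep_cproj \<xi> \<in> torus" for \<xi>
    using g[OF that] poly_map_component_torus[OF that] by (simp_all add: abs_rep_cproj domIff)
  have hom: "homogeneous (laurent_degree B) (monomial_component B i)" for i
    using homogeneous_single[of "exponent_vector B i" 1] exponent_vector_degree[of B i]
    by (simp add: monomial_component_eq)
  show "\<exists>P. reduced_form g (laurent_degree B) P"
  proof (rule exI[of _ "monomial_component B"], unfold reduced_form_def, intro conjI allI)
    show "homogeneous (laurent_degree B) (monomial_component B i)" for i by (rule hom)
    show "no_common_factor (monomial_component B)"
      unfolding no_common_factor_def
    proof (intro allI impI)
      fix h assume "\<forall>i. h dvd monomial_component B i"
      then obtain c where c: "c \<noteq> 0" "h = Poly_Mapping.single 0 c"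
        using dvd_monomials_imp_constant[of h "exponent_vector B"] exponent_vector_min[of B]
        unfolding monomial_component_eq by metis
      then have "1 = h * Poly_Mapping.single 0 (inverse c)" by (simp add: mult_single)
      then show "h dvd 1" by (rule dvdI)
    qed
    show "zariski_dense {\<xi> \<in> dom g. g \<xi> = poly_map (monomial_component B) \<xi>}"
      by (rule zariski_dense_torus) (use gr in auto)
  qed
  fix d assume "\<exists>P. reduced_form g d P"
  then obtain P where hP: "\<And>i. homogeneous d (P i)" and ncf: "no_common_factor P"
    and dense: "zariski_dense {\<xi> \<in> dom g. g \<xi> = poly_map P \<xi>}"
    by (auto simp: reduced_form_def)
  show "d = laurent_degree B"
  proof (rule monomials_proportional_degree[of "exponent_vector B" _ d P])
    show "P i * Poly_Mapping.single (exponent_vector B k) 1 = P k * Poly_Mapping.single (exponent_vector B i) 1" for i k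
    proof -
      let ?M = "monomial_component B"
      have "peval (P i * ?M k - P k * ?M i) (rep_cproj \<xi>) = 0"
        if "g \<xi> = poly_map P \<xi>" and x: "rep_cproj \<xi> \<in> torus" for \<xi>
      proof -
        let ?x = "rep_cproj \<xi>"
        have eq: "poly_map P \<xi> = poly_map ?M \<xi>" using that gr by simp
        obtain e where e: "e \<noteq> 0" "(\<chi> i. peval (?M i) ?x) = e *s laurent_map B ?x"
          by (rule components_eq_multiple_laurent_map[OF x])
        have nz: "(\<chi> i. peval (?M i) ?x) \<noteq> 0"
          using e torus_nonzero[OF torus_scale[OF laurent_map_torus[OF x] e(1)]] by simp
        have nz': "(\<chi> i. peval (P i) ?x) \<noteq> 0"
          and "abs_cproj (\<chi> i. peval (?M i) ?x) = abs_cproj (\<chi> i. peval (P i) ?x)"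
          using eq nz by (auto simp: poly_map_def Let_def split: if_splits)
        then obtain c where c: "(\<chi> i. peval (P i) ?x) = c *s (\<chi> i. peval (?M i) ?x)"
          using abs_cproj_eqD[OF nz nz'] by blast
        have "peval (P i) ?x = c * peval (?M i) ?x" for i
          using arg_cong[OF c, of "\<lambda>v. v $ i"] by simp
        then show ?thesis by (simp add: peval_diff peval_mult)
      qed
      then have "P i * ?M k - P k * ?M i = 0"
        using zariski_dense_inter_torus[OF dense]
          homogeneous_diff[OF homogeneous_mult[OF hP[of i] hom[of k]] homogeneous_mult[OF hP[of k] hom[of i]]]
        unfolding zariski_dense_def by blast
      then show ?thesis by (simp add: monomial_component_eq)
    qed
  qed (use hP ncf exponent_vector_min exponent_vector_degree in \<open>auto simp: no_common_factor_def\<close>)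
qed

lemma map_degree_iterate: "map_degree (map_iter (monomial_map A) N) = laurent_degree (mat_power A N)"
  by (rule map_degree_eq) (rule map_iter_torus)

text \<open>A negative exponent has to be cleared, so it contributes to the degree. A positive exponent is
balanced by negative ones in its row.\<close>
lemma entry_le_degree: "\<bar>B $ i $ j\<bar> \<le> int (laurent_degree B)"
proof -
  have neg: "- laurent_exponent B k l \<le> int (laurent_degree B)" for k l
  proof -
    have "- least_exponent B l \<le> (\<Sum>j\<in>UNIV. - least_exponent B j)"
      by (rule member_le_sum) (use least_exponent_le_0 in auto)
    then show ?thesis using least_exponent_le[of B l k] by (simp add: int_laurent_degree)
  qed
  have pos: "laurent_exponent B k l \<le> int (laurent_degree B)" for k l
  proof -
    have "laurent_exponent B k l = - (\<Sum>j\<in>UNIV - {l}. laurent_exponent B k j)"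
      using sum.remove[of UNIV l "laurent_exponent B k"] laurent_exponent_row_sum[of B k] by simp
    also have "\<dots> \<le> (\<Sum>j\<in>UNIV - {l}. - least_exponent B j)"
      unfolding sum_negf[symmetric] by (rule sum_mono) (use least_exponent_le in auto)
    also have "\<dots> \<le> (\<Sum>j\<in>UNIV. - least_exponent B j)"
      by (rule sum_mono2) (use least_exponent_le_0 in auto)
    finally show ?thesis by (simp add: int_laurent_degree)
  qed
  from neg[of "Some i" "Some j"] pos[of "Some i" "Some j"] show ?thesis by simp
qed

lemma degree_le_entries:
  fixes B :: "int ^ 'n ^ 'n"
  assumes b: "\<And>i j. real_of_int \<bar>B $ i $ j\<bar> \<le> b"
  shows "real (laurent_degree B) \<le> real (CARD('n) + 1) * (real CARD('n) * b)"
proof -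
  have b0: "0 \<le> b" using b[of undefined undefined] by linarith
  have card1: "1 \<le> real CARD('n)" by (simp add: Suc_leI)
  have bn: "b \<le> real CARD('n) * b" using mult_right_mono[OF card1 b0] by simp
  have L: "- real_of_int (laurent_exponent B i j) \<le> real CARD('n) * b" for i j
  proof (cases i)
    case None
    then show ?thesis using b0 by simp
  next
    case (Some a)
    have abs: "real_of_int (B $ a $ k) \<le> b" "- real_of_int (B $ a $ k) \<le> b" for k
      using b[of a k] by linarith+
    show ?thesis
    proof (cases j)
      case None
      have "(\<Sum>k\<in>UNIV. real_of_int (B $ a $ k)) \<le> (\<Sum>k\<in>(UNIV :: 'n set). b)"
        by (rule sum_mono) (rule abs)
      then show ?thesis by (simp add: Some None)
    next
      case (Some k)
      then show ?thesis using \<open>i = _\<close> abs(2)[of k] bn by simp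
    qed
  qed
  have "- real_of_int (least_exponent B j) \<le> real CARD('n) * b" for j
  proof -
    have "least_exponent B j \<in> range (\<lambda>k. laurent_exponent B k j)"
      unfolding least_exponent_def by (rule Min_in) auto
    then show ?thesis using L by auto
  qed
  then have "(\<Sum>j\<in>(UNIV :: 'n option set). - real_of_int (least_exponent B j))
      \<le> (\<Sum>j\<in>(UNIV :: 'n option set). real CARD('n) * b)"
    by (intro sum_mono)
  moreover have "real (laurent_degree B) = (\<Sum>j\<in>UNIV. - real_of_int (least_exponent B j))"
    using arg_cong[OF int_laurent_degree[of B], of real_of_int] by simp
  ultimately show ?thesis by (simp add: card_UNIV_option)
qed

section \<open>Algebraic entropy\<close>

text \<open>The lower bound has the exact rate \<open>\<rho>\<close>, whereas the upper bound is needed only for every larger rate: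
constants disappear in the limit.\<close>
lemma exponential_growth_rate:
  fixes D :: "nat \<Rightarrow> real"
  assumes \<rho>: "0 < \<rho>" and lower: "\<And>N. \<rho> ^ N \<le> K * D N"
    and upper: "\<And>r. \<rho> < r \<Longrightarrow> \<exists>C. \<forall>N. D N \<le> C * r ^ N" and D0: "\<And>N. 0 \<le> D N"
  shows "(\<lambda>N. ln (D N) / real N) \<longlonglongrightarrow> ln \<rho>"
proof (rule order_tendstoI)
  have KD: "0 < K * D N" for N using lower[of N] \<rho> by (meson less_le_trans zero_less_power)
  then have D: "0 < D N" and K: "0 < K" for N using D0 by (meson less_eq_real_def not_less zero_less_mult_iff)+
  have lim: "(\<lambda>N. (c + real N * s) / real N) \<longlonglongrightarrow> s" for c s :: real by real_asymp
  {
    fix s assume s: "s < ln \<rho>"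
    have "(- ln K + real N * ln \<rho>) / real N \<le> ln (D N) / real N" for N
    proof (rule divide_right_mono)
      have "ln (\<rho> ^ N) \<le> ln (K * D N)" using lower[of N] \<rho> KD by (subst ln_le_cancel_iff) auto
      then show "- ln K + real N * ln \<rho> \<le> ln (D N)"
        using \<rho> K D[of N] by (simp add: ln_mult ln_realpow)
    qed simp
    then show "eventually (\<lambda>N. s < ln (D N) / real N) sequentially"
      by (intro eventually_mono[OF order_tendstoD(1)[OF lim s]]) (rule less_le_trans)
  next
    fix s assume s: "ln \<rho> < s"
    then obtain u where u: "ln \<rho> < u" "u < s" using dense by blast
    have "\<rho> < exp u" using u(1) \<rho> by (metis exp_less_cancel_iff exp_ln)
    then obtain C where C: "\<And>N. D N \<le> C * exp u ^ N" using upper by blast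
    have C0: "0 < C" using C[of 0] D[of 0] by simp
    have "ln (D N) / real N \<le> (ln C + real N * u) / real N" for N
    proof (rule divide_right_mono)
      have "ln (D N) \<le> ln (C * exp u ^ N)" using C[of N] D[of N] C0 by (subst ln_le_cancel_iff) auto
      then show "ln (D N) \<le> ln C + real N * u" using C0 by (simp add: ln_mult ln_realpow)
    qed simp
    then show "eventually (\<lambda>N. ln (D N) / real N < s) sequentially"
      by (intro eventually_mono[OF order_tendstoD(2)[OF lim u(2)]]) (rule le_less_trans)
  }
qed

lemma funpow_transpose:
  fixes v :: "complex ^ 'n"
  shows "((*v) (transpose (map_matrix of_int A)) ^^ N) v = transpose (map_matrix of_int (mat_power A N)) *v v"
proof (induction N arbitrary: v)
  case 0
  have "transpose (map_matrix of_int (mat 1)) = (mat 1 :: complex ^ 'n ^ 'n)"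
    by (simp add: vec_eq_iff transpose_def map_matrix_def mat_def)
  then show ?case by simp
next
  case (Suc N)
  have "map_matrix of_int (A ** mat_power A N) = map_matrix of_int A ** (map_matrix of_int (mat_power A N) :: complex ^ 'n ^ 'n)"
    by (simp add: vec_eq_iff map_matrix_def matrix_matrix_mult_def)
  then show ?case
    by (simp add: funpow_Suc_right Suc matrix_vector_mul_assoc matrix_transpose_mul
        del: funpow.simps transpose_matrix_vector)
qed

text \<open>The degrees of the iterates grow like the entries of the powers of \<open>A\<close>, and these grow at the rate of
the largest eigenvalue. The eigenvector \<open>x\<close> gives the lower bound, the orbits of the unit vectors give
the upper bound.\<close>
lemma algebraic_entropy_eq:
  fixes A :: "int ^ 'n ^ 'n"
  defines "B \<equiv> transpose (map_matrix of_int A) :: complex ^ 'n ^ 'n"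
  assumes x: "x \<noteq> 0" "B *v x = \<alpha> *s x" and \<alpha>: "\<alpha> \<noteq> 0"
    and max: "\<And>z. norm \<alpha> < norm z \<Longrightarrow> det (mat z - B) \<noteq> 0"
  shows "algebraic_entropy (monomial_map A) = ln (norm \<alpha>)"
proof -
  define D where "D N = real (laurent_degree (mat_power A N))" for N
  have orbit: "((*v) B ^^ N) v $ i = (\<Sum>j\<in>UNIV. of_int (mat_power A N $ j $ i) * v $ j)" for N v i
    unfolding B_def funpow_transpose
    by (simp add: matrix_vector_mult_def transpose_def map_matrix_def del: transpose_matrix_vector)
  have entry: "norm (of_int (mat_power A N $ j $ i) :: complex) \<le> D N" for N i j
    using entry_le_degree[of "mat_power A N" j i] unfolding D_def norm_of_int by linarith
  obtain k where k: "x $ k \<noteq> 0" using x(1) by (auto simp: vec_eq_iff)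
  have eigen: "((*v) B ^^ N) x = \<alpha> ^ N *s x" for N
    by (induction N) (simp_all add: vector_scalar_commute x(2) vector_smult_assoc mult.commute)
  have lower: "norm \<alpha> ^ N \<le> ((\<Sum>j\<in>UNIV. norm (x $ j)) / norm (x $ k)) * D N" for N
  proof -
    have "norm \<alpha> ^ N * norm (x $ k) = norm (((*v) B ^^ N) x $ k)"
      by (simp add: eigen norm_mult norm_power)
    also have "\<dots> \<le> (\<Sum>j\<in>UNIV. norm (of_int (mat_power A N $ j $ k) * x $ j))"
      unfolding orbit by (rule norm_sum)
    also have "\<dots> \<le> (\<Sum>j\<in>UNIV. D N * norm (x $ j))"
      by (rule sum_mono) (simp only: norm_mult mult_right_mono[OF entry] norm_ge_zero)
    finally show ?thesis using k by (simp add: field_simps sum_distrib_left)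
  qed
  have upper: "\<exists>C. \<forall>N. D N \<le> C * r ^ N" if r: "norm \<alpha> < r" for r
  proof -
    have r0: "0 < r" using r norm_ge_zero by (rule le_less_trans[rotated])
    have "\<exists>C. \<forall>N. norm (((*v) B ^^ N) (axis i 1)) \<le> C * r ^ N" for i
      by (rule matrix_orbit_growth[OF r0]) (use max r in auto)
    then obtain C where C: "\<And>i N. norm (((*v) B ^^ N) (axis i 1)) \<le> C i * r ^ N" by metis
    define b where "b = (\<Sum>i\<in>UNIV. \<bar>C i\<bar>)"
    have "real_of_int \<bar>mat_power A N $ i $ j\<bar> \<le> b * r ^ N" for N i j
    proof -
      have "((*v) B ^^ N) (axis i 1) $ j = of_int (mat_power A N $ i $ j)"
        by (simp add: orbit axis_def if_distrib cong: if_cong)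
      then have "real_of_int \<bar>mat_power A N $ i $ j\<bar> = norm (((*v) B ^^ N) (axis i 1) $ j)"
        by simp
      also have "\<dots> \<le> norm (((*v) B ^^ N) (axis i 1))" by (rule Finite_Cartesian_Product.norm_nth_le)
      also have "\<dots> \<le> C i * r ^ N" by (rule C)
      also have "\<dots> \<le> b * r ^ N"
      proof (rule mult_right_mono)
        have "\<bar>C i\<bar> \<le> b" unfolding b_def by (rule member_le_sum) auto
        then show "C i \<le> b" by linarith
      qed (use r0 in simp)
      finally show ?thesis .
    qed
    then have "D N \<le> real (CARD('n) + 1) * (real CARD('n) * (b * r ^ N))" for N
      unfolding D_def by (rule degree_le_entries)
    then show ?thesis
      by (intro exI[of _ "real (CARD('n) + 1) * (real CARD('n) * b)"]) (simp add: mult.assoc)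
  qed
  have "(\<lambda>N. ln (D N) / real N) \<longlonglongrightarrow> ln (norm \<alpha>)"
    by (rule exponential_growth_rate[OF _ lower upper]) (simp_all add: \<alpha> D_def)
  then show ?thesis
    unfolding algebraic_entropy_def map_degree_iterate D_def by (rule limI)
qed

section \<open>Lower bounds for the Bowen-Dinaburg entropy\<close>

lemma ln_enat_mono:
  assumes "s \<le> t"
  shows "ln_enat s \<le> ln_enat t"
proof (cases t)
  case (enat b)
  then obtain a where a: "s = enat a" "a \<le> b" using assms by (cases s) auto
  have "ln (real a) \<le> ln (real b)"
  proof (cases "a = 0")
    case True
    then show ?thesis by (cases "b = 0") auto
  qed (use a in simp)
  then show ?thesis using a enat by (simp add: ln_enat_def)
qed (simp add: ln_enat_def)

lemma separated_limsup_antimono: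
  assumes "\<epsilon> \<le> \<epsilon>'"
  shows "limsup (\<lambda>N. ln_enat (max_separated U d T N \<epsilon>') / ereal (real N))
      \<le> limsup (\<lambda>N. ln_enat (max_separated U d T N \<epsilon>) / ereal (real N))"
proof (rule Limsup_mono)
  have "max_separated U d T N \<epsilon>' \<le> max_separated U d T N \<epsilon>" for N
    unfolding max_separated_def
    by (rule Sup_subset_mono) (use assms in \<open>force simp: bowen_separated_def\<close>)
  then show "eventually (\<lambda>N. ln_enat (max_separated U d T N \<epsilon>') / ereal (real N)
      \<le> ln_enat (max_separated U d T N \<epsilon>) / ereal (real N)) sequentially"
    by (intro eventually_mono[OF eventually_gt_at_top[of 0]] ereal_divide_right_mono ln_enat_mono) auto
qed

text \<open>Smaller \<open>\<epsilon>\<close> allow more separated points, so the limit as \<open>\<epsilon>\<close> tends to 0 is a supremum, and one scale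
suffices for a lower bound.\<close>
lemma entropy_ge_limsup:
  assumes "0 < \<eta>"
  shows "limsup (\<lambda>N. ln_enat (max_separated U d T N \<eta>) / ereal (real N)) \<le> bowen_dinaburg_entropy U d T"
proof -
  define F where "F \<epsilon> = limsup (\<lambda>N. ln_enat (max_separated U d T N \<epsilon>) / ereal (real N))" for \<epsilon>
  have anti: "F \<epsilon>' \<le> F \<epsilon>" if "\<epsilon> \<le> \<epsilon>'" for \<epsilon> \<epsilon>'
    unfolding F_def using that by (rule separated_limsup_antimono)
  define L where "L = (SUP \<epsilon>\<in>{0<..}. F \<epsilon>)"
  have up: "F \<epsilon> \<le> L" if "0 < \<epsilon>" for \<epsilon> unfolding L_def using that by (intro SUP_upper) auto
  have "(F \<longlongrightarrow> L) (at_right 0)"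
  proof (rule order_tendstoI)
    fix a assume "a < L"
    then obtain \<epsilon>0 where "0 < \<epsilon>0" "a < F \<epsilon>0" unfolding L_def less_SUP_iff by auto
    then show "eventually (\<lambda>\<epsilon>. a < F \<epsilon>) (at_right 0)"
      unfolding eventually_at_right_field using anti by (meson less_imp_le less_le_trans)
  next
    fix a assume "L < a"
    then show "eventually (\<lambda>\<epsilon>. F \<epsilon> < a) (at_right 0)"
      unfolding eventually_at_right_field using up by (meson le_less_trans zero_less_one)
  qed
  then have "bowen_dinaburg_entropy U d T = L"
    unfolding bowen_dinaburg_entropy_def F_def by (intro tendsto_Lim) auto
  then show ?thesis using up[OF assms] by (simp add: F_def)
qed

text \<open>The denominator \<open>M + 1\<close> is subexponential and does not affect the rate; it leaves room for the linear
factor that a Jordan block produces.\<close>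
lemma entropy_ge_exponential:
  assumes \<eta>: "0 < \<eta>" and c: "0 < c" and \<theta>: "0 < \<theta>"
    and E: "\<And>M. \<exists>E\<subseteq>U. finite E \<and> bowen_separated d T (Suc M) \<eta> E \<and> c * \<theta> ^ M / (real M + 1) \<le> real (card E)"
  shows "ereal (ln \<theta>) \<le> bowen_dinaburg_entropy U d T"
proof -
  define g where "g N = (ln c + (real N - 1) * ln \<theta> - ln (real N)) / real N" for N
  have "g \<longlonglongrightarrow> ln \<theta>" unfolding g_def by real_asymp
  then have "limsup (\<lambda>N. ereal (g N)) = ereal (ln \<theta>)" by (intro lim_imp_Limsup) auto
  moreover have "limsup (\<lambda>N. ereal (g N)) \<le> limsup (\<lambda>N. ln_enat (max_separated U d T N \<eta>) / ereal (real N))"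
  proof (rule Limsup_mono, rule eventually_mono[OF eventually_gt_at_top[of 0]])
    fix N :: nat assume "0 < N"
    then obtain M where M: "N = Suc M" using gr0_implies_Suc by blast
    obtain F where F: "F \<subseteq> U" "finite F" "bowen_separated d T N \<eta> F" "c * \<theta> ^ M / (real M + 1) \<le> real (card F)"
      using E[of M] M by auto
    have pos: "0 < c * \<theta> ^ M / (real M + 1)" using c \<theta> by simp
    have "ln c + (real N - 1) * ln \<theta> - ln (real N) = ln (c * \<theta> ^ M / (real M + 1))"
      using c \<theta> by (simp add: M ln_mult ln_div ln_realpow add.commute)
    also have "\<dots> \<le> ln (real (card F))" using F(4) pos by (subst ln_le_cancel_iff) linarith+
    finally have "ereal (ln c + (real N - 1) * ln \<theta> - ln (real N)) \<le> ln_enat (enat (card F))"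
      by (simp add: ln_enat_def)
    also have "\<dots> \<le> ln_enat (max_separated U d T N \<eta>)"
      unfolding max_separated_def by (rule ln_enat_mono, rule Sup_upper) (use F in blast)
    finally have "ereal (ln c + (real N - 1) * ln \<theta> - ln (real N)) / ereal (real N)
        \<le> ln_enat (max_separated U d T N \<eta>) / ereal (real N)"
      using \<open>0 < N\<close> by (intro ereal_divide_right_mono) auto
    then show "ereal (g N) \<le> ln_enat (max_separated U d T N \<eta>) / ereal (real N)"
      using \<open>0 < N\<close> by (simp add: g_def)
  qed
  ultimately show ?thesis using entropy_ge_limsup[OF \<eta>] by (metis order_trans)
qed

section \<open>The compact torus inside projective space\<close>

text \<open>Angles are measured in full turns, so that integer translations of \<open>\<theta>\<close> do not change the point.\<close>
definition angle_point :: "real ^ 'n \<Rightarrow> complex ^ 'n option" where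
  "angle_point \<theta> = (\<chi> i. case i of None \<Rightarrow> 1 | Some j \<Rightarrow> cis (2 * pi * \<theta> $ j))"

lemma angle_point_torus: "angle_point \<theta> \<in> torus"
  by (simp add: angle_point_def torus_def split: option.split)

lemma cis_sum: "cis (\<Sum>i\<in>I. f i) = (\<Prod>i\<in>I. cis (f i))"
  by (induction I rule: infinite_finite_induct) (simp_all flip: cis_mult)

text \<open>On the compact torus the map is the toral endomorphism induced by \<open>A\<close>.\<close>
lemma laurent_map_angle_point:
  "laurent_map A (angle_point \<theta>) = angle_point (map_matrix real_of_int A *v \<theta>)"
proof -
  have "laurent_map A (angle_point \<theta>) $ i = angle_point (map_matrix real_of_int A *v \<theta>) $ i" for i
  proof (cases i)
    case (Some a)
    have "laurent_map A (angle_point \<theta>) $ i = (\<Prod>j\<in>UNIV. cis (2 * pi * \<theta> $ j) powi A $ a $ j)"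
      by (simp add: laurent_map_def angle_point_def Some UNIV_option_conv prod.reindex)
    also have "\<dots> = cis (\<Sum>j\<in>UNIV. of_int (A $ a $ j) * (2 * pi * \<theta> $ j))"
      by (simp add: cis_power_int cis_sum)
    also have "(\<Sum>j\<in>UNIV. of_int (A $ a $ j) * (2 * pi * \<theta> $ j)) = 2 * pi * (map_matrix real_of_int A *v \<theta>) $ a"
      by (simp add: matrix_vector_mult_def map_matrix_def sum_distrib_left mult_ac)
    finally show ?thesis by (simp add: angle_point_def Some)
  qed (simp add: laurent_map_def angle_point_def)
  then show ?thesis by (simp add: vec_eq_iff)
qed

lemma angle_point_defined: "abs_cproj (angle_point \<theta>) \<in> forever_defined (monomial_map A)"
  by (simp add: forever_defined_def domIff map_iter_torus[OF angle_point_torus])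

lemma angle_point_orbit:
  "((the \<circ> monomial_map A) ^^ k) (abs_cproj (angle_point \<theta>))
    = abs_cproj (angle_point (((*v) (map_matrix real_of_int A) ^^ k) \<theta>))"
  by (induction k) (simp_all add: monomial_map_def poly_map_component_torus[OF angle_point_torus] laurent_map_angle_point)

lemma angle_point_dist:
  fixes \<theta> \<phi> :: "real ^ 'n"
  shows "cproj_dist (abs_cproj (angle_point \<theta>)) (abs_cproj (angle_point \<phi>))
    = arccos (norm (1 + (\<Sum>j\<in>UNIV. cis (2 * pi * (\<theta> - \<phi>) $ j))) / (real CARD('n) + 1))"
proof -
  have refl: "proj_rel x x" if "x \<in> torus" for x :: "complex ^ 'n option"
    using torus_nonzero[OF that] by (auto simp: proj_rel_def intro: exI[of _ 1])
  have "norm (angle_point \<theta>) ^ 2 = real CARD('n) + 1" for \<theta> :: "real ^ 'n"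
    by (simp add: norm_vec_def L2_set_def real_sqrt_pow2 sum_nonneg sum_option angle_point_def)
  then have "norm (angle_point \<theta>) = sqrt (real CARD('n) + 1)" for \<theta> :: "real ^ 'n"
    by (metis norm_ge_zero real_sqrt_abs real_sqrt_unique)
  moreover have "hermitian_inner (angle_point \<theta>) (angle_point \<phi>) = 1 + (\<Sum>j\<in>UNIV. cis (2 * pi * (\<theta> - \<phi>) $ j))"
    by (simp add: hermitian_inner_def sum_option angle_point_def cis_cnj cis_mult algebra_simps)
  ultimately show ?thesis
    by (simp add: cproj_dist.abs_eq refl[OF angle_point_torus])
qed

lemma norm_one_plus_cis: "norm (1 + cis (2 * t)) = 2 * \<bar>cos t\<bar>"
proof -
  have "(norm (1 + cis (2 * t)))\<^sup>2 = (1 + cos (2 * t))\<^sup>2 + (sin (2 * t))\<^sup>2"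
    by (simp add: cmod_power2)
  also have "\<dots> = 2 + 2 * cos (2 * t)"
    using sin_cos_squared_add[of "2 * t"] by (simp add: power2_eq_square algebra_simps)
  also have "\<dots> = (2 * \<bar>cos t\<bar>)\<^sup>2"
    by (simp add: cos_double_cos power_mult_distrib)
  finally show ?thesis by (rule power2_eq_imp_eq) auto
qed

text \<open>A lower bound for the projective distance of two points one of whose angles differs by at least \<open>\<epsilon>\<close>
turns. The numerator is \<open>n - 1 + |1 + exp(2 \<pi> i \<epsilon>)|\<close>: in the Hermitian product, the summand of that
angle is paired with the constant summand 1 of the last homogeneous coordinate.\<close>
definition angle_gap :: "'n::finite itself \<Rightarrow> real \<Rightarrow> real" where
  "angle_gap _ \<epsilon> = arccos ((real CARD('n) - 1 + 2 * cos (pi * \<epsilon>)) / (real CARD('n) + 1))"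

lemma cos_pi_mult_nonneg:
  assumes "0 \<le> t" "t \<le> 1/2"
  shows "0 \<le> cos (pi * t)"
proof (rule cos_ge_zero)
  have "0 \<le> pi * t" using assms by simp
  then show "- (pi / 2) \<le> pi * t" using pi_gt_zero by linarith
  show "pi * t \<le> pi / 2" using assms mult_left_mono[of t "1/2" pi] by simp
qed

lemma angle_gap_pos:
  assumes "0 < \<epsilon>" "\<epsilon> \<le> 1/2"
  shows "0 < angle_gap TYPE('n::finite) \<epsilon>"
proof -
  have "cos (pi * \<epsilon>) < cos 0" using assms by (intro cos_monotone_0_pi) auto
  moreover have "0 \<le> cos (pi * \<epsilon>)"
    using assms by (intro cos_pi_mult_nonneg) auto
  moreover have "1 \<le> real CARD('n)" by (simp add: Suc_leI)
  ultimately have "(real CARD('n) - 1 + 2 * cos (pi * \<epsilon>)) / (real CARD('n) + 1) < 1"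
    "0 \<le> (real CARD('n) - 1 + 2 * cos (pi * \<epsilon>)) / (real CARD('n) + 1)"
    by (auto simp: divide_simps)
  then show ?thesis
    using arccos_less_arccos[of "(real CARD('n) - 1 + 2 * cos (pi * \<epsilon>)) / (real CARD('n) + 1)" 1]
    by (simp add: angle_gap_def)
qed

text \<open>In the Hermitian product the summand of the angle \<open>j\<close> is not aligned with the constant summand 1, and
the triangle inequality bounds the others by \<open>n - 1\<close>. As the difference is at most half a turn, it is
not close to a nonzero integer.\<close>
lemma angle_gap_le_dist:
  fixes \<theta> \<phi> :: "real ^ 'n"
  assumes \<epsilon>: "0 \<le> \<epsilon>" and j: "\<epsilon> \<le> \<bar>(\<theta> - \<phi>) $ j\<bar>" "\<bar>(\<theta> - \<phi>) $ j\<bar> \<le> 1/2"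
  shows "angle_gap TYPE('n) \<epsilon> \<le> cproj_dist (abs_cproj (angle_point \<theta>)) (abs_cproj (angle_point \<phi>))"
proof -
  define w where "w = \<theta> - \<phi>"
  have n: "1 \<le> real CARD('n)" by (simp add: Suc_leI)
  have "cos (pi * \<bar>w $ j\<bar>) \<le> cos (pi * \<epsilon>)"
    using \<epsilon> j by (intro cos_monotone_0_pi_le) (auto simp: w_def)
  moreover have "0 \<le> cos (pi * \<bar>w $ j\<bar>)"
    using j by (intro cos_pi_mult_nonneg) (auto simp: w_def)
  moreover have "cos (pi * \<bar>w $ j\<bar>) = cos (pi * w $ j)" by (simp add: abs_if)
  ultimately have c: "\<bar>cos (pi * w $ j)\<bar> \<le> cos (pi * \<epsilon>)" by simp
  have "norm (1 + (\<Sum>k\<in>UNIV. cis (2 * pi * w $ k)))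
      = norm ((1 + cis (2 * (pi * w $ j))) + (\<Sum>k\<in>UNIV - {j}. cis (2 * pi * w $ k)))"
    by (subst sum.remove[of UNIV j]) (auto simp: mult.assoc add.assoc)
  also have "\<dots> \<le> norm (1 + cis (2 * (pi * w $ j))) + (\<Sum>k\<in>UNIV - {j}. norm (cis (2 * pi * w $ k)))"
    by (intro order_trans[OF norm_triangle_ineq] add_left_mono norm_sum)
  also have "\<dots> \<le> real CARD('n) - 1 + 2 * cos (pi * \<epsilon>)"
    using c n by (simp add: norm_one_plus_cis card_Diff_singleton)
  finally have le: "norm (1 + (\<Sum>k\<in>UNIV. cis (2 * pi * w $ k))) \<le> real CARD('n) - 1 + 2 * cos (pi * \<epsilon>)" .
  have "(real CARD('n) - 1 + 2 * cos (pi * \<epsilon>)) / (real CARD('n) + 1) \<le> 1"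
    using n cos_le_one[of "pi * \<epsilon>"] by (simp add: divide_simps)
  moreover have "-1 \<le> norm (1 + (\<Sum>k\<in>UNIV. cis (2 * pi * w $ k))) / (real CARD('n) + 1)"
    by (rule order_trans[of _ 0]) simp_all
  ultimately show ?thesis
    unfolding angle_point_dist angle_gap_def w_def[symmetric]
    using divide_right_mono[OF le, of "real CARD('n) + 1"] by (simp add: arccos_le_arccos)
qed

lemma angle_point_dist_same: "cproj_dist (abs_cproj (angle_point \<theta>)) (abs_cproj (angle_point \<theta>)) = 0"
  for \<theta> :: "real ^ 'n"
proof -
  have "norm (1 + (of_nat CARD('n) :: complex)) = real CARD('n) + 1"
    by (metis add.commute norm_of_nat of_nat_Suc)
  then show ?thesis by (simp add: angle_point_dist)
qed

section \<open>Two expanding real functionals\<close>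

text \<open>Along an orbit the values \<open>a\<close> and \<open>b\<close> of the two functionals satisfy a triangular recursion that
expands. If they are bounded at time \<open>M\<close>, they must have been exponentially small at time 0. The
coupling \<open>c\<close> costs at most \<open>|c| K\<close> in each step, since \<open>|a k|\<close> decays backwards at least as fast as
\<open>|\<mu>|\<close> demands.\<close>
lemma backward_decay:
  fixes a b :: "nat \<Rightarrow> complex"
  assumes a: "\<And>k. a (Suc k) = \<alpha> * a k" and b: "\<And>k. b (Suc k) = \<mu> * b k + c * a k"
    and ord: "1 \<le> norm \<mu>" "norm \<mu> \<le> norm \<alpha>"
    and K: "norm (a M) \<le> K" "norm (b M) \<le> K"
  shows "norm (a 0) * norm \<alpha> ^ M \<le> K" and "norm (b 0) * norm \<mu> ^ M \<le> K * (1 + norm c * real M)"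
proof -
  have pow: "a (k + M) = \<alpha> ^ M * a k" for k M
    by (induction M) (simp_all add: a)
  have "norm (a M) = norm (a 0) * norm \<alpha> ^ M"
    using pow[of 0 M] by (simp add: norm_mult norm_power)
  then show "norm (a 0) * norm \<alpha> ^ M \<le> K" using K by simp
  show "norm (b 0) * norm \<mu> ^ M \<le> K * (1 + norm c * real M)"
    using a b K
  proof (induction M arbitrary: a b)
    case (Suc M)
    have IH: "norm (b (Suc 0)) * norm \<mu> ^ M \<le> K * (1 + norm c * real M)"
      by (rule Suc.IH[of "\<lambda>k. a (Suc k)" "\<lambda>k. b (Suc k)"]) (use Suc.prems in auto)
    have pow: "a M = \<alpha> ^ M * a 0" for M
      by (induction M) (simp_all add: Suc.prems(1))
    have aK: "norm (a 0) * norm \<mu> ^ M \<le> K"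
    proof -
      have "norm \<mu> ^ M \<le> norm \<alpha> ^ M" using ord by (intro power_mono) auto
      also have "\<dots> \<le> norm \<alpha> ^ Suc M" using ord by (intro power_increasing) auto
      finally have "norm (a 0) * norm \<mu> ^ M \<le> norm (a 0) * norm \<alpha> ^ Suc M"
        by (intro mult_left_mono) auto
      also have "\<dots> = norm (a (Suc M))" by (simp only: pow[of "Suc M"] norm_mult norm_power mult.commute)
      finally show ?thesis using Suc.prems(3) by simp
    qed
    have "norm (b 0) * norm \<mu> \<le> norm (b (Suc 0)) + norm c * norm (a 0)"
      using norm_triangle_ineq4[of "b (Suc 0)" "c * a 0"] by (simp add: Suc.prems(2) norm_mult mult.commute)
    then have "norm (b 0) * norm \<mu> ^ Suc M \<le> (norm (b (Suc 0)) + norm c * norm (a 0)) * norm \<mu> ^ M"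
      using mult_right_mono[of "norm (b 0) * norm \<mu>" _ "norm \<mu> ^ M"] by (simp add: mult.assoc)
    also have "\<dots> \<le> K * (1 + norm c * real M) + norm c * K"
      using IH mult_left_mono[OF aK, of "norm c"] by (simp add: algebra_simps)
    also have "\<dots> = K * (1 + norm c * real (Suc M))" by (simp add: algebra_simps)
    finally show ?case .
  qed simp
qed

text \<open>Bilinear, without complex conjugation, so that moving \<open>A\<close> to the other side transposes it.\<close>
definition pairing :: "complex ^ 'n \<Rightarrow> real ^ 'n \<Rightarrow> complex" where
  "pairing x w = (\<Sum>j\<in>UNIV. x $ j * of_real (w $ j))"

lemma pairing_matrix:
  "pairing x (map_matrix real_of_int A *v w) = pairing (transpose (map_matrix of_int A) *v x) w"
proof -
  have "pairing x (map_matrix real_of_int A *v w)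
      = (\<Sum>j\<in>UNIV. \<Sum>i\<in>UNIV. of_int (A $ j $ i) * x $ j * of_real (w $ i))"
    by (simp add: pairing_def matrix_vector_mult_def map_matrix_def sum_distrib_left mult_ac)
  also have "\<dots> = (\<Sum>i\<in>UNIV. \<Sum>j\<in>UNIV. of_int (A $ j $ i) * x $ j * of_real (w $ i))"
    by (rule sum.swap)
  also have "\<dots> = pairing (transpose (map_matrix of_int A) *v x) w"
    by (simp add: pairing_def matrix_vector_mult_def transpose_def map_matrix_def sum_distrib_right
        del: transpose_matrix_vector)
  finally show ?thesis .
qed

lemma pairing_add_scale: "pairing (a *s x + b *s y) w = a * pairing x w + b * pairing y w"
  by (simp add: pairing_def algebra_simps sum.distrib sum_distrib_left)

lemma norm_pairing_le: "norm (pairing x w) \<le> (\<Sum>j\<in>UNIV. norm (x $ j)) * norm w"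
proof -
  have "norm (pairing x w) \<le> (\<Sum>j\<in>UNIV. norm (x $ j * of_real (w $ j)))"
    unfolding pairing_def by (rule norm_sum)
  also have "\<dots> \<le> (\<Sum>j\<in>UNIV. norm (x $ j) * norm w)"
    by (intro sum_mono) (simp add: norm_mult mult_left_mono component_le_norm_cart)
  finally show ?thesis by (simp add: sum_distrib_right)
qed

definition Re_vec :: "complex ^ 'n \<Rightarrow> real ^ 'n" where "Re_vec x = (\<chi> j. Re (x $ j))"
definition Im_vec :: "complex ^ 'n \<Rightarrow> real ^ 'n" where "Im_vec x = (\<chi> j. Im (x $ j))"

lemma inner_Re_Im_le: "\<bar>Re_vec x \<bullet> w\<bar> \<le> norm (pairing x w)" "\<bar>Im_vec x \<bullet> w\<bar> \<le> norm (pairing x w)"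
proof -
  have "Re_vec x \<bullet> w = Re (pairing x w)" "Im_vec x \<bullet> w = Im (pairing x w)"
    by (simp_all add: pairing_def Re_vec_def Im_vec_def inner_vec_def)
  then show "\<bar>Re_vec x \<bullet> w\<bar> \<le> norm (pairing x w)" "\<bar>Im_vec x \<bullet> w\<bar> \<le> norm (pairing x w)"
    by (simp_all add: abs_Re_le_cmod abs_Im_le_cmod)
qed

text \<open>If the real and imaginary parts of \<open>x\<close> and \<open>y\<close> were all multiples of one real vector, then \<open>x\<close> and \<open>y\<close>
would be linearly dependent over the complex numbers. This replaces a case distinction between real
and nonreal eigenvalues.\<close>
lemma independent_real_functionals:
  fixes x y :: "complex ^ 'n"
  assumes indep: "\<And>a b. a *s x + b *s y = 0 \<Longrightarrow> a = 0 \<and> b = 0"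
  obtains u v where "\<And>w. \<bar>u \<bullet> w\<bar> \<le> norm (pairing x w)"
    "(\<forall>w. \<bar>v \<bullet> w\<bar> \<le> norm (pairing x w)) \<or> (\<forall>w. \<bar>v \<bullet> w\<bar> \<le> norm (pairing y w))"
    "u \<noteq> 0" "\<And>t. v \<noteq> t *\<^sub>R u"
proof -
  have "x \<noteq> 0" using indep[of 1 0] by auto
  then have "Re_vec x \<noteq> 0 \<or> Im_vec x \<noteq> 0"
    by (auto simp: vec_eq_iff Re_vec_def Im_vec_def complex_eq_iff)
  then obtain u where u: "u \<noteq> 0" "\<And>w. \<bar>u \<bullet> w\<bar> \<le> norm (pairing x w)"
    using inner_Re_Im_le by metis
  have "\<exists>v\<in>{Re_vec x, Im_vec x, Re_vec y, Im_vec y}. \<forall>t. v \<noteq> t *\<^sub>R u"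
  proof (rule ccontr)
    assume "\<not> ?thesis"
    then obtain p q r s where pq: "Re_vec x = p *\<^sub>R u" "Im_vec x = q *\<^sub>R u"
      "Re_vec y = r *\<^sub>R u" "Im_vec y = s *\<^sub>R u" by auto
    have xc: "x $ j = Complex p q * of_real (u $ j)" for j
      using arg_cong[OF pq(1), of "\<lambda>v. v $ j"] arg_cong[OF pq(2), of "\<lambda>v. v $ j"]
      by (simp add: Re_vec_def Im_vec_def complex_eq_iff)
    have yc: "y $ j = Complex r s * of_real (u $ j)" for j
      using arg_cong[OF pq(3), of "\<lambda>v. v $ j"] arg_cong[OF pq(4), of "\<lambda>v. v $ j"]
      by (simp add: Re_vec_def Im_vec_def complex_eq_iff)
    have "Complex r s *s x + (- Complex p q) *s y = 0"
      by (simp add: vec_eq_iff xc yc)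
    from indep[OF this] have "Complex p q = 0" by simp
    then have "x = 0" by (simp add: vec_eq_iff xc)
    with \<open>x \<noteq> 0\<close> show False ..
  qed
  then obtain v where v: "v \<in> {Re_vec x, Im_vec x, Re_vec y, Im_vec y}" "\<And>t. v \<noteq> t *\<^sub>R u" by blast
  then have "(\<forall>w. \<bar>v \<bullet> w\<bar> \<le> norm (pairing x w)) \<or> (\<forall>w. \<bar>v \<bullet> w\<bar> \<le> norm (pairing y w))"
    using inner_Re_Im_le by blast
  with u v show thesis by (intro that)
qed

text \<open>Up to normalization, \<open>g\<close> and \<open>h\<close> are the components of \<open>u\<close> and \<open>v\<close> orthogonal to the other vector;
both \<open>u \<bullet> g\<close> and \<open>v \<bullet> h\<close> are then the Gram determinant.\<close>
lemma dual_vectors: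
  fixes u v :: "real ^ 'n"
  assumes u: "u \<noteq> 0" and v: "\<And>t. v \<noteq> t *\<^sub>R u"
  obtains g h where "u \<bullet> g = 1" "v \<bullet> g = 0" "u \<bullet> h = 0" "v \<bullet> h = 1"
proof -
  define g where "g = (v \<bullet> v) *\<^sub>R u - (u \<bullet> v) *\<^sub>R v"
  define h where "h = (u \<bullet> u) *\<^sub>R v - (u \<bullet> v) *\<^sub>R u"
  have uh: "u \<bullet> h = 0" "v \<bullet> g = 0" and eq: "u \<bullet> g = v \<bullet> h"
    by (simp_all add: g_def h_def inner_diff_right inner_commute mult.commute)
  have "h \<noteq> 0"
  proof
    assume "h = 0"
    then have "(u \<bullet> u) *\<^sub>R v = (u \<bullet> v) *\<^sub>R u" by (simp add: h_def)
    then have "v = ((u \<bullet> v) / (u \<bullet> u)) *\<^sub>R u"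
      using u by (metis divide_inverse_commute inner_eq_zero_iff real_vector.scale_scale
          scaleR_one right_inverse mult.commute)
    with v show False by blast
  qed
  moreover have "h \<bullet> h = (u \<bullet> u) * (v \<bullet> h)"
    using uh(1) by (subst (1) h_def) (simp add: inner_diff_left)
  ultimately have nz: "v \<bullet> h \<noteq> 0" by auto
  show thesis
    by (rule that[of "inverse (v \<bullet> h) *\<^sub>R g" "inverse (v \<bullet> h) *\<^sub>R h"]) (use nz uh eq in auto)
qed

section \<open>Separated points on the compact torus\<close>

text \<open>Passing from the linear map to the torus, the difference must not be lost modulo integers. At the first
time at which the linear orbit of the difference exceeds \<open>1 / (2 R)\<close>, it is still at most \<open>1/2\<close>, because one
step expands by at most \<open>R\<close>. At that time the distance on the torus is the linear one.\<close>
lemma separation_of_angle_points: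
  fixes A :: "int ^ 'n ^ 'n" and \<theta> \<phi> :: "real ^ 'n"
  defines "F \<equiv> (*v) (map_matrix real_of_int A)"
  assumes R: "1 \<le> R" "\<And>w. norm (F w) \<le> R * norm w"
    and small: "norm (\<theta> - \<phi>) \<le> 1/2" and large: "1 / (2 * R) < norm ((F ^^ M) (\<theta> - \<phi>))"
  defines "T \<equiv> the \<circ> monomial_map A"
  shows "\<exists>k\<le>M. angle_gap TYPE('n) (1 / (2 * R * real CARD('n)))
    \<le> cproj_dist ((T ^^ k) (abs_cproj (angle_point \<theta>))) ((T ^^ k) (abs_cproj (angle_point \<phi>)))"
proof -
  have diff: "(F ^^ k) (\<theta> - \<phi>) = (F ^^ k) \<theta> - (F ^^ k) \<phi>" for k
    by (induction k) (simp_all add: F_def matrix_vector_mult_diff_distrib)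
  define k where "k = (LEAST k. 1 / (2 * R) < norm ((F ^^ k) (\<theta> - \<phi>)))"
  have k: "1 / (2 * R) < norm ((F ^^ k) (\<theta> - \<phi>))" "k \<le> M"
    unfolding k_def using large by (auto intro: LeastI Least_le)
  have half: "norm ((F ^^ k) (\<theta> - \<phi>)) \<le> 1/2"
  proof (cases k)
    case 0
    then show ?thesis using small by simp
  next
    case (Suc l)
    then have "\<not> 1 / (2 * R) < norm ((F ^^ l) (\<theta> - \<phi>))"
      using not_less_Least[of l "\<lambda>k. 1 / (2 * R) < norm ((F ^^ k) (\<theta> - \<phi>))"] unfolding k_def by auto
    then have "R * norm ((F ^^ l) (\<theta> - \<phi>)) \<le> R * (1 / (2 * R))"
      using R(1) by (intro mult_left_mono) auto
    also have "\<dots> = 1/2" using R(1) by simp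
    finally show ?thesis using R(2)[of "(F ^^ l) (\<theta> - \<phi>)"] Suc by simp
  qed
  define w where "w = (F ^^ k) \<theta> - (F ^^ k) \<phi>"
  have "\<exists>j. 1 / (2 * R * real CARD('n)) \<le> \<bar>w $ j\<bar>"
  proof (rule ccontr)
    assume "\<not> ?thesis"
    then have "(\<Sum>j\<in>UNIV. \<bar>w $ j\<bar>) \<le> (\<Sum>j\<in>(UNIV :: 'n set). 1 / (2 * R * real CARD('n)))"
      by (intro sum_mono) (auto simp: not_le less_imp_le)
    also have "\<dots> = 1 / (2 * R)" by simp
    finally show False using norm_le_l1_cart[of w] k(1) by (simp add: w_def diff)
  qed
  then obtain j where j: "1 / (2 * R * real CARD('n)) \<le> \<bar>w $ j\<bar>" by blast
  have "\<bar>w $ j\<bar> \<le> 1/2"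
    using order_trans[OF component_le_norm_cart half] by (simp add: w_def diff)
  then have "angle_gap TYPE('n) (1 / (2 * R * real CARD('n)))
      \<le> cproj_dist (abs_cproj (angle_point ((F ^^ k) \<theta>))) (abs_cproj (angle_point ((F ^^ k) \<phi>)))"
    using R(1) j unfolding w_def by (intro angle_gap_le_dist) auto
  then show ?thesis using k(2) by (auto simp: T_def F_def angle_point_orbit)
qed


text \<open>The points form a grid in the plane spanned by the vectors \<open>g\<close> and \<open>h\<close> dual to the real functionals
\<open>u\<close> and \<open>v\<close>, inside a ball of fixed size. Its spacings are twice the bounds that follow from \<open>backward_decay\<close>
for the differences of points that stay together up to time \<open>M\<close>, so any two grid points separate.\<close>
lemma separated_family:
  fixes A :: "int ^ 'n ^ 'n"
  defines "B \<equiv> transpose (map_matrix of_int A) :: complex ^ 'n ^ 'n"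
  assumes x: "B *v x = \<alpha> *s x" and y: "B *v y = \<mu> *s y + c *s x"
    and indep: "\<And>a b. a *s x + b *s y = 0 \<Longrightarrow> a = 0 \<and> b = 0"
    and ord: "1 < norm \<mu>" "norm \<mu> \<le> norm \<alpha>"
  obtains \<eta> C where "0 < \<eta>" "0 < C"
    "\<And>M. \<exists>E\<subseteq>forever_defined (monomial_map A). finite E
      \<and> bowen_separated cproj_dist (the \<circ> monomial_map A) (Suc M) \<eta> E
      \<and> C * (norm \<alpha> * norm \<mu>) ^ M / (real M + 1) \<le> real (card E)"
proof -
  define F where "F = (*v) (map_matrix real_of_int A)"
  define T where "T = the \<circ> monomial_map A"
  obtain R0 where R0: "\<And>w. norm (F w) \<le> norm w * R0"
    using bounded_linear.bounded[OF matrix_vector_mul_bounded_linear[of "map_matrix real_of_int A"]]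
    unfolding F_def by blast
  define R where "R = max 1 R0"
  have R: "1 \<le> R" "norm (F w) \<le> R * norm w" for w
  proof -
    have "norm w * R0 \<le> norm w * R" by (intro mult_left_mono) (auto simp: R_def)
    with R0[of w] show "norm (F w) \<le> R * norm w" by (simp add: mult.commute)
  qed (simp add: R_def)
  obtain u v where u: "\<And>w. \<bar>u \<bullet> w\<bar> \<le> norm (pairing x w)"
    and v: "(\<forall>w. \<bar>v \<bullet> w\<bar> \<le> norm (pairing x w)) \<or> (\<forall>w. \<bar>v \<bullet> w\<bar> \<le> norm (pairing y w))"
    and uv: "u \<noteq> 0" "\<And>t. v \<noteq> t *\<^sub>R u"
    using independent_real_functionals[OF indep] by blast
  obtain g h where gh: "u \<bullet> g = 1" "v \<bullet> g = 0" "u \<bullet> h = 0" "v \<bullet> h = 1"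
    using dual_vectors[OF uv] by blast
  have gh0: "0 < norm g" "0 < norm h" using gh by auto
  define S where "S = (\<Sum>j\<in>UNIV. norm (x $ j)) + (\<Sum>j\<in>UNIV. norm (y $ j))"
  \<comment> \<open>Bounds both functionals on the ball of radius \<open>1 / (2 R)\<close>; the summand 1 makes it positive.\<close>
  define K where "K = S * (1 / (2 * R)) + 1"
  define K' where "K' = K * (1 + norm c)"
  have S: "(\<Sum>j\<in>UNIV. norm (x $ j)) \<le> S" "(\<Sum>j\<in>UNIV. norm (y $ j)) \<le> S" "0 \<le> S"
    by (auto simp: S_def sum_nonneg)
  have K: "0 < K" using S(3) R(1) by (simp add: K_def add_nonneg_pos)
  have K': "0 < K'" using K by (simp add: K'_def add_pos_nonneg)
  define \<eta> where "\<eta> = angle_gap TYPE('n) (1 / (2 * R * real CARD('n))) / 2"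
  have \<eta>: "0 < \<eta>"
  proof -
    have "1 * 1 \<le> R * real CARD('n)" using R(1) by (intro mult_mono) (auto simp: Suc_leI)
    then show ?thesis unfolding \<eta>_def using R(1)
      by (intro half_gt_zero angle_gap_pos) (auto simp: divide_simps)
  qed
  have decay: "\<bar>u \<bullet> w\<bar> \<le> K / norm \<alpha> ^ M \<and> \<bar>v \<bullet> w\<bar> \<le> K' * (real M + 1) / norm \<mu> ^ M"
    if w: "norm ((F ^^ M) w) \<le> 1 / (2 * R)" for M w
  proof -
    have small: "norm (pairing z ((F ^^ M) w)) \<le> K" if "(\<Sum>j\<in>UNIV. norm (z $ j)) \<le> S" for z
    proof -
      have "norm (pairing z ((F ^^ M) w)) \<le> S * (1 / (2 * R))"
        by (rule order_trans[OF norm_pairing_le]) (use that w S(3) in \<open>intro mult_mono, auto\<close>)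
      then show ?thesis by (simp add: K_def)
    qed
    have px: "pairing x ((F ^^ Suc k) w) = \<alpha> * pairing x ((F ^^ k) w)" for k
      using pairing_matrix[of x A] pairing_add_scale[of \<alpha> x 0 y] by (simp add: F_def x[unfolded B_def] del: transpose_matrix_vector)
    have py: "pairing y ((F ^^ Suc k) w) = \<mu> * pairing y ((F ^^ k) w) + c * pairing x ((F ^^ k) w)" for k
      using pairing_matrix[of y A] pairing_add_scale[of \<mu> y c x] by (simp add: F_def y[unfolded B_def] del: transpose_matrix_vector)
    note bd = backward_decay[of "\<lambda>k. pairing x ((F ^^ k) w)" \<alpha> "\<lambda>k. pairing y ((F ^^ k) w)" \<mu> c M K,
        OF px py less_imp_le[OF ord(1)] ord(2) small[OF S(1)] small[OF S(2)], simplified]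
    have \<alpha>p: "0 < norm \<alpha> ^ M" and \<mu>p: "0 < norm \<mu> ^ M"
      using less_trans[OF zero_less_one ord(1)] less_le_trans[OF less_trans[OF zero_less_one ord(1)] ord(2)]
      by (simp_all only: zero_less_power)
    have xM: "norm (pairing x w) * norm \<alpha> ^ M \<le> K" by (rule bd(1))
    have "\<bar>u \<bullet> w\<bar> * norm \<alpha> ^ M \<le> K"
      using mult_right_mono[OF u[of w], of "norm \<alpha> ^ M"] xM by simp
    moreover have "\<bar>v \<bullet> w\<bar> * norm \<mu> ^ M \<le> K' * (real M + 1)"
      using v
    proof
      assume "\<forall>w. \<bar>v \<bullet> w\<bar> \<le> norm (pairing x w)"
      then have "\<bar>v \<bullet> w\<bar> * norm \<mu> ^ M \<le> norm (pairing x w) * norm \<alpha> ^ M"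
        using ord by (intro mult_mono power_mono) auto
      also have "\<dots> \<le> K * 1" using xM by simp
      also have "\<dots> \<le> K * ((1 + norm c) * (real M + 1))"
        using K mult_mono[of 1 "1 + norm c" 1 "real M + 1"] by (intro mult_left_mono) auto
      finally show ?thesis by (simp add: K'_def mult.assoc)
    next
      assume "\<forall>w. \<bar>v \<bullet> w\<bar> \<le> norm (pairing y w)"
      then have "\<bar>v \<bullet> w\<bar> * norm \<mu> ^ M \<le> norm (pairing y w) * norm \<mu> ^ M"
        using \<mu>p by (intro mult_right_mono) auto
      also have "\<dots> \<le> K * (1 + norm c * real M)" by (rule bd(2))
      also have "\<dots> \<le> K * ((1 + norm c) * (real M + 1))"
        using K by (intro mult_left_mono) (auto simp: algebra_simps)
      finally show ?thesis by (simp add: K'_def mult.assoc)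
    qed
    ultimately show ?thesis using \<alpha>p \<mu>p by (simp add: pos_le_divide_eq)
  qed
  \<comment> \<open>The factor \<open>64 = (4 \<cdot> 2)\<^sup>2\<close> collects the 4 from the extent of the grid and the 2 from its spacing, in each direction.\<close>
  define C where "C = 1 / (64 * K * K' * norm g * norm h)"
  have C: "0 < C" using K K' gh0 by (simp add: C_def)
  have fam: "\<exists>E\<subseteq>forever_defined (monomial_map A). finite E
      \<and> bowen_separated cproj_dist T (Suc M) \<eta> E
      \<and> C * (norm \<alpha> * norm \<mu>) ^ M / (real M + 1) \<le> real (card E)" for M
  proof -
    define s where "s = 2 * K / norm \<alpha> ^ M"
    define t where "t = 2 * K' * (real M + 1) / norm \<mu> ^ M"
    have \<alpha>p: "0 < norm \<alpha> ^ M" and \<mu>p: "0 < norm \<mu> ^ M"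
      using less_trans[OF zero_less_one ord(1)] less_le_trans[OF less_trans[OF zero_less_one ord(1)] ord(2)]
      by (simp_all only: zero_less_power)
    have st: "0 < s" "0 < t" using K K' \<alpha>p \<mu>p by (auto simp: s_def t_def)
    \<comment> \<open>Each side of the grid has extent at most 1/4, so that differences of grid points have norm at most 1/2.\<close>
    have count: "\<exists>J. a \<le> real J \<and> (\<forall>i<J. \<forall>j<J. \<bar>real i - real j\<bar> \<le> a)" if "0 < a" for a :: real
    proof (intro exI[of _ "nat \<lfloor>a\<rfloor> + 1"] conjI allI impI)
      show "a \<le> real (nat \<lfloor>a\<rfloor> + 1)" using that by linarith
      fix i j assume "i < nat \<lfloor>a\<rfloor> + 1" "j < nat \<lfloor>a\<rfloor> + 1"
      then have "real i \<le> a" "real j \<le> a" using that by linarith+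
      then show "\<bar>real i - real j\<bar> \<le> a" by linarith
    qed
    obtain J where J: "1 / (4 * s * norm g) \<le> real J"
      "\<And>i j. i < J \<Longrightarrow> j < J \<Longrightarrow> \<bar>real i - real j\<bar> \<le> 1 / (4 * s * norm g)"
      using count[of "1 / (4 * s * norm g)"] st gh0 by auto
    obtain L where L: "1 / (4 * t * norm h) \<le> real L"
      "\<And>i j. i < L \<Longrightarrow> j < L \<Longrightarrow> \<bar>real i - real j\<bar> \<le> 1 / (4 * t * norm h)"
      using count[of "1 / (4 * t * norm h)"] st gh0 by auto
    define I where "I = {..<J} \<times> {..<L}"
    define p where "p q = (real (fst q) * s) *\<^sub>R g + (real (snd q) * t) *\<^sub>R h" for q :: "nat \<times> nat"
    define z where "z q = abs_cproj (angle_point (p q))" for q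
    have sep: "\<exists>k\<le>M. 2 * \<eta> \<le> cproj_dist ((T ^^ k) (z q)) ((T ^^ k) (z q'))"
      if q: "q \<in> I" "q' \<in> I" "q \<noteq> q'" for q q'
    proof -
      define a where "a = (real (fst q) - real (fst q')) * s"
      define b where "b = (real (snd q) - real (snd q')) * t"
      have pd: "p q - p q' = a *\<^sub>R g + b *\<^sub>R h"
        by (simp add: p_def a_def b_def algebra_simps)
      have "\<bar>a\<bar> * norm g \<le> 1 / (4 * s * norm g) * s * norm g"
        using J(2)[of "fst q" "fst q'"] q st unfolding a_def abs_mult
        by (intro mult_mono) (auto simp: I_def)
      moreover have "\<bar>b\<bar> * norm h \<le> 1 / (4 * t * norm h) * t * norm h"
        using L(2)[of "snd q" "snd q'"] q st unfolding b_def abs_mult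
        by (intro mult_mono) (auto simp: I_def)
      ultimately have "\<bar>a\<bar> * norm g \<le> 1/4" "\<bar>b\<bar> * norm h \<le> 1/4" using st gh0 by auto
      moreover have "norm (p q - p q') \<le> \<bar>a\<bar> * norm g + \<bar>b\<bar> * norm h"
        unfolding pd by (rule order_trans[OF norm_triangle_ineq]) simp
      ultimately have near: "norm (p q - p q') \<le> 1/2" by linarith
      have far: "1 / (2 * R) < norm ((F ^^ M) (p q - p q'))"
      proof (rule ccontr)
        assume "\<not> ?thesis"
        then have "\<bar>u \<bullet> (p q - p q')\<bar> \<le> K / norm \<alpha> ^ M"
          "\<bar>v \<bullet> (p q - p q')\<bar> \<le> K' * (real M + 1) / norm \<mu> ^ M"
          using decay[of M "p q - p q'"] by auto
        then have ab: "2 * \<bar>a\<bar> \<le> s" "2 * \<bar>b\<bar> \<le> t"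
          by (simp_all add: pd inner_add_right gh s_def t_def)
        have "fst q = fst q'"
        proof (rule ccontr)
          assume "fst q \<noteq> fst q'"
          then have "1 \<le> \<bar>real (fst q) - real (fst q')\<bar>" by linarith
          then have "1 * s \<le> \<bar>a\<bar>" unfolding a_def abs_mult using st by (intro mult_mono) auto
          with ab st show False by linarith
        qed
        moreover have "snd q = snd q'"
        proof (rule ccontr)
          assume "snd q \<noteq> snd q'"
          then have "1 \<le> \<bar>real (snd q) - real (snd q')\<bar>" by linarith
          then have "1 * t \<le> \<bar>b\<bar>" unfolding b_def abs_mult using st by (intro mult_mono) auto
          with ab st show False by linarith
        qed
        ultimately show False using q(3) by (simp add: prod_eq_iff)
      qed
      show ?thesis
        using separation_of_angle_points[OF R(1) R(2)[unfolded F_def] near far[unfolded F_def]]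
        by (simp add: z_def T_def \<eta>_def)
    qed
    have inj: "inj_on z I"
    proof (rule inj_onI, rule ccontr)
      fix q q' assume q: "q \<in> I" "q' \<in> I" "z q = z q'" "q \<noteq> q'"
      then obtain k where "2 * \<eta> \<le> cproj_dist ((T ^^ k) (z q)) ((T ^^ k) (z q))"
        using sep[of q q'] by auto
      then show False using \<eta> by (simp add: z_def T_def angle_point_orbit angle_point_dist_same)
    qed
    have "bowen_separated cproj_dist T (Suc M) \<eta> (z ` I)"
      unfolding bowen_separated_def
    proof (intro ballI impI)
      fix P Q assume "P \<in> z ` I" "Q \<in> z ` I" "P \<noteq> Q"
      then obtain q q' where q: "q \<in> I" "q' \<in> I" "q \<noteq> q'" "P = z q" "Q = z q'" by auto
      then obtain k where k: "k \<le> M" "2 * \<eta> \<le> cproj_dist ((T ^^ k) P) ((T ^^ k) Q)"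
        using sep by blast
      have "\<eta> < cproj_dist ((T ^^ k) P) ((T ^^ k) Q)" using k(2) \<eta> by linarith
      also have "\<dots> \<le> Max ((\<lambda>k. cproj_dist ((T ^^ k) P) ((T ^^ k) Q)) ` {..<Suc M})"
        by (rule Max_ge) (use k(1) in auto)
      finally show "\<eta> < Max ((\<lambda>k. cproj_dist ((T ^^ k) P) ((T ^^ k) Q)) ` {..<Suc M})" .
    qed
    moreover have "C * (norm \<alpha> * norm \<mu>) ^ M / (real M + 1) \<le> real (card (z ` I))"
    proof -
      have "C * (norm \<alpha> * norm \<mu>) ^ M / (real M + 1) = 1 / (4 * s * norm g) * (1 / (4 * t * norm h))"
        by (simp add: C_def s_def t_def power_mult_distrib mult_ac)
      also have "\<dots> \<le> real J * real L"
        using J(1) L(1) st gh0 by (intro mult_mono) auto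
      also have "\<dots> = real (card (z ` I))" using card_image[OF inj] by (simp add: I_def)
      finally show ?thesis .
    qed
    moreover have "finite (z ` I)" "z ` I \<subseteq> forever_defined (monomial_map A)"
      by (auto simp: I_def z_def angle_point_defined)
    ultimately show ?thesis by blast
  qed
  show thesis by (rule that[OF \<eta> C fam[unfolded T_def]])
qed

theorem corollary6p3:
  fixes A :: "int ^ 'n ^ 'n"
  assumes "det A \<noteq> 0"
    and "size {# z \<in># eigenvalues A. norm z > 1 #} \<ge> 2"
  shows "ereal (algebraic_entropy (monomial_map A)) < topological_entropy (monomial_map A)"
proof -
  define B :: "complex ^ 'n ^ 'n" where "B = transpose (map_matrix of_int A)"
  define p where "p = charpoly A"
  have p: "poly p z = det (mat z - B)" for z unfolding p_def B_def by (rule charpoly_eval)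
  have sz: "size {# z \<in># proots p. norm z > 1 #} \<ge> 2"
    using assms(2) by (simp add: eigenvalues_def p_def)
  then have nz: "p \<noteq> 0" by auto
  have "set_mset (proots p) \<noteq> {}" using sz by auto
  then have "Max (norm ` set_mset (proots p)) \<in> norm ` set_mset (proots p)" by (intro Max_in) auto
  then obtain \<alpha> where \<alpha>: "\<alpha> \<in># proots p" "norm \<alpha> = Max (norm ` set_mset (proots p))" by auto
  have max: "norm z \<le> norm \<alpha>" if "z \<in># proots p" for z
    unfolding \<alpha>(2) using that by (intro Max_ge) auto
  obtain Q where Q: "proots p = add_mset \<alpha> Q" using \<alpha>(1) by (meson multi_member_split)
  have "1 \<le> size {# z \<in># Q. norm z > 1 #}" using sz unfolding Q by (simp split: if_splits)
  then obtain \<mu> where "\<mu> \<in># {# z \<in># Q. norm z > 1 #}" by (metis multiset_nonemptyE not_one_le_zero size_empty)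
  then have \<mu>: "\<mu> \<in># Q" "1 < norm \<mu>" by auto
  have ord: "norm \<mu> \<le> norm \<alpha>" by (rule max) (simp add: Q \<mu>(1))
  have sub: "{#\<alpha>, \<mu>#} \<subseteq># proots p" using \<mu>(1) by (simp add: Q)
  obtain x y c where xy: "B *v x = \<alpha> *s x" "B *v y = \<mu> *s y + c *s x"
    and indep: "\<And>a b. a *s x + b *s y = 0 \<Longrightarrow> a = 0 \<and> b = 0"
    using triangular_pair[OF p nz sub] by blast
  have x0: "x \<noteq> 0" using indep[of 1 0] by auto
  have "algebraic_entropy (monomial_map A) = ln (norm \<alpha>)"
  proof (rule algebraic_entropy_eq[OF x0 xy(1)[unfolded B_def]])
    show "\<alpha> \<noteq> 0" using \<mu>(2) ord by auto
    show "det (mat z - transpose (map_matrix complex_of_int A)) \<noteq> 0" if "norm \<alpha> < norm z" for z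
      using max[of z] that nz p[of z] by (auto simp: B_def)
  qed
  moreover have "ln (norm \<alpha>) < ln (norm \<alpha> * norm \<mu>)"
  proof -
    have "0 < norm \<alpha>" using \<mu>(2) ord by linarith
    moreover have "0 < norm \<mu>" "0 < ln (norm \<mu>)" using \<mu>(2) by (auto intro: ln_gt_zero)
    ultimately show ?thesis by (simp add: ln_mult)
  qed
  moreover have "ereal (ln (norm \<alpha> * norm \<mu>)) \<le> topological_entropy (monomial_map A)"
  proof -
    obtain \<eta> C where "0 < \<eta>" "0 < C" and fam: "\<And>M. \<exists>E\<subseteq>forever_defined (monomial_map A). finite E
      \<and> bowen_separated cproj_dist (the \<circ> monomial_map A) (Suc M) \<eta> E
      \<and> C * (norm \<alpha> * norm \<mu>) ^ M / (real M + 1) \<le> real (card E)"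
      using separated_family[OF xy[unfolded B_def] indep \<mu>(2) ord] by blast
    moreover have "0 < norm \<alpha>" "0 < norm \<mu>" using \<mu>(2) ord by linarith+
    then have "0 < norm \<alpha> * norm \<mu>" by simp
    ultimately show ?thesis
      unfolding topological_entropy_def by (intro entropy_ge_exponential)
  qed
  ultimately show ?thesis by (metis less_ereal.simps(1) less_le_trans)
qed

end
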